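(* Let $\alpha,\beta\in\mathbb{Z}$. Then the following conditions (i), (ii), (iii) and (iv) on a function $f\in L^2([0,2\pi])$ are equivalent. (i) $\widehat f(\alpha)=\widehat f(\beta)=0$. (ii) There are $m,s\in\mathbb{N}$, $b_1,b_2,\ldots,b_m\in[0,2\pi]$ and $f_1,f_2,\ldots,f_m\in L^2([0,2\pi])$ such that $$f=\sum_{j=1}^m\left[\left(e^{ib_j\left(\frac{\alpha-\beta}{2}\right)}+e^{-ib_j\left(\frac{\alpha-\beta}{2}\right)}\right)\delta_0-\left(e^{ib_j\left(\frac{\alpha+\beta}{2}\right)}\delta_{b_j}+e^{-ib_j\left(\frac{\alpha+\beta}{2}\right)}\delta_{-b_j}\right)\right]^s\ast f_j.$$ (iii) There are $s\in\mathbb{N}$, $b_1,b_2,\ldots,b_{4s+1}\in[0,2\pi]$ and $f_1,f_2,\ldots,f_{4s+1}\in L^2([0,2\pi])$ such that $$f=\sum_{j=1}^{4s+1}\left[\left(e^{ib_j\left(\frac{\alpha-\beta}{2}\right)}+e^{-ib_j\left(\frac{\alpha-\beta}{2}\right)}\right)\delta_0-\left(e^{ib_j\left(\frac{\alpha+\beta}{2}\right)}\delta_{b_j}+e^{-ib_j\left(\frac{\alpha+\beta}{2}\right)}\delta_{-b_j}\right)\right]^s\ast f_j.\qquad(\ast)$$ (iv) There are $s\in\mathbb{N}$ and $g\in W^{2s}([0,2\pi])$ such that $\big(D^2-i(\alpha+\beta)D-\alpha\beta I\big)^s(g)=f$. Moreover, when the equivalent conditions (i)–(iv) are satisfied by $f$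 and $s\in\mathbb{N}$ is given, for almost all $(b_1,b_2,\ldots,b_{4s+1})\in[0,2\pi]^{4s+1}$ (with respect to Lebesgue measure) there are $f_1,f_2,\ldots,f_{4s+1}\in L^2([0,2\pi])$ such that $(\ast)$ holds. Also, for given $s\in\mathbb{N}$, the functions $f\in L^2([0,2\pi])$ that can be written in the form $(\ast)$ (for some $b_1,\ldots,b_{4s+1}\in[0,2\pi]$ and $f_1,\ldots,f_{4s+1}\in L^2([0,2\pi])$) form a closed vector subspace of $L^2([0,2\pi])$.
   Context: $\mathbb{N}$ is the set of positive integers. The circle group $\mathbb{T}=\{z\in\mathbb{C}:|z|=1\}$ is identified with $[0,2\pi)$ (or $[0,2\pi]$ with endpoints identified) via $x\mapsto e^{ix}$, with addition modulo $2\pi$; $L^2([0,2\pi])=L^2(\mathbb{T})$ is the Hilbert space of square integrable complex functions. For $f\in L^2([0,2\pi])$ and $n\in\mathbb{Z}$, $\widehat f(n)=\frac{1}{2\pi}\int_0^{2\pi}f(t)e^{-int}\,dt$. $\delta_x$ is the Dirac measure at $x$, with $x$ (and $-x$) read modulo $2\pi$; $\ast$ is convolution on the circle group, of measures with measures and of measures with $L^2$ functions; for a bounded complex Borel measure $\mu$ and $s\in\mathbb{N}$, $\mu^s=\mu\ast\cdots\ast\mu$ ($s$ factors) is the convolution power. For $k=0,1,2,\ldots$, $W^k([0,2\pi])=W^k(\mathbb{T})=\{f\in L^2(\mathbb{T}):\sum_{n=-\infty}^{\infty}|n|^{2k}|\widehat f(n)|^2<\infty\}$. $D$ is the differentiation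 operator, $D:W^1(\mathbb{T})\to L^2(\mathbb{T})$, determined by $\widehat{D(f)}(n)=in\widehat f(n)$ for all $n\in\mathbb{Z}$; $I$ is the identity operator. Thus $(D^2-i(\alpha+\beta)D-\alpha\beta I)^s:W^{2s}(\mathbb{T})\to L^2(\mathbb{T})$ is the operator with $\big[(D^2-i(\alpha+\beta)D-\alpha\beta I)^s(f)\big]^{\wedge}(n)=(-1)^s(n-\alpha)^s(n-\beta)^s\widehat f(n)$ for all $n\in\mathbb{Z}$. *)

theory Defs
  imports "HOL-Analysis.Analysis" "HOL-Library.Real_Mod" "HOL-Library.Function_Algebras"
begin

text \<open>
  The circle group is realised as \<open>{0..<2 * pi}\<close> with addition modulo \<open>2 * pi\<close>; \<open>circle\<close> carries
  the Borel sets and (unnormalised) Lebesgue measure.  Elements of \<open>L2\<close> are Borel functions rather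
  than classes, so equations between them are to be stated almost everywhere on \<open>circle\<close>; values
  outside \<open>{0..<2 * pi}\<close> play no role.
\<close>

definition circle :: "real measure" where
  "circle = restrict_space lborel {0..<2 * pi}"

definition L2 :: "(real \<Rightarrow> complex) set" where
  "L2 = {f \<in> borel_measurable circle. integrable circle (\<lambda>t. (cmod (f t))\<^sup>2)}"

definition L2_norm :: "(real \<Rightarrow> complex) \<Rightarrow> real" where
  "L2_norm f = sqrt (LINT t|circle. (cmod (f t))\<^sup>2)"

definition L2_topology :: "(real \<Rightarrow> complex) topology" where
  "L2_topology = topology (\<lambda>U. U \<subseteq> L2 \<and>
     (\<forall>f\<in>U. \<exists>e>0. \<forall>g\<in>L2. L2_norm (g - f) < e \<longrightarrow> g \<in> U))"

lemma openin_L2_topology: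
  "openin L2_topology U \<longleftrightarrow>
     U \<subseteq> L2 \<and> (\<forall>f\<in>U. \<exists>e>0. \<forall>g\<in>L2. L2_norm (g - f) < e \<longrightarrow> g \<in> U)"
proof -
  have "istopology (\<lambda>U. U \<subseteq> L2 \<and>
     (\<forall>f\<in>U. \<exists>e>0. \<forall>g\<in>L2. L2_norm (g - f) < e \<longrightarrow> g \<in> U))"
    unfolding istopology_def
  proof (intro conjI allI impI)
    fix S T
    assume S: "S \<subseteq> L2 \<and> (\<forall>f\<in>S. \<exists>e>0. \<forall>g\<in>L2. L2_norm (g - f) < e \<longrightarrow> g \<in> S)"
      and T: "T \<subseteq> L2 \<and> (\<forall>f\<in>T. \<exists>e>0. \<forall>g\<in>L2. L2_norm (g - f) < e \<longrightarrow> g \<in> T)"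
    show "S \<inter> T \<subseteq> L2" using S by blast
    show "\<forall>f\<in>S \<inter> T. \<exists>e>0. \<forall>g\<in>L2. L2_norm (g - f) < e \<longrightarrow> g \<in> S \<inter> T"
    proof
      fix f assume "f \<in> S \<inter> T"
      then obtain d e where "d > 0" "e > 0"
        "\<forall>g\<in>L2. L2_norm (g - f) < d \<longrightarrow> g \<in> S" "\<forall>g\<in>L2. L2_norm (g - f) < e \<longrightarrow> g \<in> T"
        using S T by (metis IntE)
      then show "\<exists>e>0. \<forall>g\<in>L2. L2_norm (g - f) < e \<longrightarrow> g \<in> S \<inter> T"
        by (intro exI[of _ "min d e"]) auto
    qed
  next
    fix K
    assume K: "\<forall>S\<in>K. S \<subseteq> L2 \<and> (\<forall>f\<in>S. \<exists>e>0. \<forall>g\<in>L2. L2_norm (g - f) < e \<longrightarrow> g \<in> S)"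
    show "\<Union>K \<subseteq> L2" using K by blast
    show "\<forall>f\<in>\<Union>K. \<exists>e>0. \<forall>g\<in>L2. L2_norm (g - f) < e \<longrightarrow> g \<in> \<Union>K"
    proof
      fix f assume "f \<in> \<Union>K"
      then obtain S where "S \<in> K" "f \<in> S" by blast
      with K obtain e where "e > 0" "\<forall>g\<in>L2. L2_norm (g - f) < e \<longrightarrow> g \<in> S" by meson
      with \<open>S \<in> K\<close> show "\<exists>e>0. \<forall>g\<in>L2. L2_norm (g - f) < e \<longrightarrow> g \<in> \<Union>K" by blast
    qed
  qed
  then show ?thesis
    by (simp add: L2_topology_def topology_inverse')
qed

interpretation L2_fun: vector_space "\<lambda>(c::complex) (f::real \<Rightarrow> complex) t. c * f t"
  by unfold_locales (auto simp: fun_eq_iff algebra_simps)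

definition fourier :: "(real \<Rightarrow> complex) \<Rightarrow> int \<Rightarrow> complex" where
  "fourier f n = complex_of_real (1 / (2 * pi)) * (LINT t|circle. f t * cis (- (of_int n * t)))"

definition sobolev :: "nat \<Rightarrow> (real \<Rightarrow> complex) set" where
  "sobolev k = {f \<in> L2. (\<lambda>n::int. \<bar>real_of_int n\<bar> ^ (2 * k) * (cmod (fourier f n))\<^sup>2) summable_on UNIV}"

text \<open>\<open>diff_op f\<close> is meaningful, and determined up to null sets, for \<open>f \<in> sobolev 1\<close>.\<close>

definition diff_op :: "(real \<Rightarrow> complex) \<Rightarrow> real \<Rightarrow> complex" where
  "diff_op f = (SOME g. g \<in> L2 \<and> (\<forall>n. fourier g n = \<i> * of_int n * fourier f n))"

definition quad_op :: "int \<Rightarrow> int \<Rightarrow> (real \<Rightarrow> complex) \<Rightarrow> real \<Rightarrow> complex" where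
  "quad_op \<alpha> \<beta> f = (\<lambda>t. diff_op (diff_op f) t - \<i> * of_int (\<alpha> + \<beta>) * diff_op f t - of_int (\<alpha> * \<beta>) * f t)"

text \<open>
  A bounded complex Borel measure on the circle is represented by its set function, which is taken
  to be \<open>0\<close> off the Borel sets.  Integration against it goes through the Jordan decompositions of
  its real and imaginary parts: \<open>pos_variation \<nu>\<close> is the positive variation of a bounded signed
  measure \<open>\<nu>\<close>, that is \<open>E \<mapsto> sup {\<nu> A | A \<subseteq> E}\<close> (\<open>ennreal\<close> truncates negative values, and
  \<open>A = {}\<close> contributes \<open>0\<close>), and \<open>pos_variation (- \<nu>)\<close> the negative one.
\<close>

definition pos_variation :: "(real set \<Rightarrow> real) \<Rightarrow> real measure" where
  "pos_variation \<nu> = measure_of (space circle) (sets circle)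
     (\<lambda>E. SUP A\<in>{A \<in> sets circle. A \<subseteq> E}. ennreal (\<nu> A))"

definition signed_integral :: "(real set \<Rightarrow> real) \<Rightarrow> (real \<Rightarrow> complex) \<Rightarrow> complex" where
  "signed_integral \<nu> g = (LINT x|pos_variation \<nu>. g x) - (LINT x|pos_variation (- \<nu>). g x)"

definition cm_integral :: "(real set \<Rightarrow> complex) \<Rightarrow> (real \<Rightarrow> complex) \<Rightarrow> complex" where
  "cm_integral \<mu> g = signed_integral (\<lambda>E. Re (\<mu> E)) g + \<i> * signed_integral (\<lambda>E. Im (\<mu> E)) g"

definition dirac :: "real \<Rightarrow> real set \<Rightarrow> complex" where
  "dirac x E = (if E \<in> sets circle \<and> x rmod (2 * pi) \<in> E then 1 else 0)"

definition conv_measure :: "(real set \<Rightarrow> complex) \<Rightarrow> (real set \<Rightarrow> complex) \<Rightarrow> real set \<Rightarrow> complex" where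
  "conv_measure \<mu> \<nu> E =
     (if E \<in> sets circle
      then cm_integral \<mu> (\<lambda>x. \<nu> {y \<in> space circle. (x + y) rmod (2 * pi) \<in> E}) else 0)"

text \<open>\<open>dirac 0\<close> is the unit for convolution, so \<open>conv_power \<mu> s\<close> has \<open>s\<close> factors \<open>\<mu>\<close>.\<close>

primrec conv_power :: "(real set \<Rightarrow> complex) \<Rightarrow> nat \<Rightarrow> real set \<Rightarrow> complex" where
  "conv_power \<mu> 0 = dirac 0"
| "conv_power \<mu> (Suc s) = conv_measure \<mu> (conv_power \<mu> s)"

definition conv_fun :: "(real set \<Rightarrow> complex) \<Rightarrow> (real \<Rightarrow> complex) \<Rightarrow> real \<Rightarrow> complex" where
  "conv_fun \<mu> f t = cm_integral \<mu> (\<lambda>y. f ((t - y) rmod (2 * pi)))"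

definition diff_measure :: "int \<Rightarrow> int \<Rightarrow> real \<Rightarrow> real set \<Rightarrow> complex" where
  "diff_measure \<alpha> \<beta> b = (\<lambda>E.
     (cis (b * (of_int (\<alpha> - \<beta>) / 2)) + cis (- (b * (of_int (\<alpha> - \<beta>) / 2)))) * dirac 0 E
     - (cis (b * (of_int (\<alpha> + \<beta>) / 2)) * dirac b E
        + cis (- (b * (of_int (\<alpha> + \<beta>) / 2))) * dirac (- b) E))"

definition is_diff_sum ::
    "int \<Rightarrow> int \<Rightarrow> nat \<Rightarrow> nat \<Rightarrow> (nat \<Rightarrow> real) \<Rightarrow> (real \<Rightarrow> complex) \<Rightarrow> bool" where
  "is_diff_sum \<alpha> \<beta> s m b f \<longleftrightarrow>
     (\<exists>F. (\<forall>j\<in>{1..m}. F j \<in> L2) \<and>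
       (AE t in circle. f t = (\<Sum>j=1..m. conv_fun (conv_power (diff_measure \<alpha> \<beta> (b j)) s) (F j) t)))"

end

theory Submission
  imports Defs
begin

text \<open>
  On the Fourier side everything is diagonal.  The measure attached to \<open>b\<close> has the coefficients
  \<open>4 sin (b (n - \<alpha>) / 2) sin (b (n - \<beta>) / 2)\<close>, called \<open>symbol\<close> below, so convolution with its
  \<open>s\<close>-th power multiplies \<open>fourier F n\<close> by the \<open>s\<close>-th power of this number; the differential operator
  multiplies by \<open>- (n - \<alpha>) (n - \<beta>)\<close>.  All these multipliers vanish at \<open>\<alpha>\<close> and \<open>\<beta>\<close>, hence each of
  (ii), (iii), (iv) implies (i).  For the converses one divides by the multipliers and needs the three
  basic facts on Fourier series: the coefficients are square summable (\<open>fourier_summable\<close>), they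
  determine the function almost everywhere (\<open>fourier_eq_imp_AE\<close>), and every square summable family
  occurs (\<open>riesz_fischer\<close>).

  For (iv) with \<open>s = 1\<close> the division is harmless because \<open>(1 + \<bar>n\<bar>)\<^sup>2\<close> is bounded by a constant times
  \<open>\<bar>n - \<alpha>\<bar> \<bar>n - \<beta>\<bar>\<close> away from the zeros.  For (iii) write \<open>m = 4 s + 1\<close> and let \<open>T b n\<close> be the sum of
  the \<open>2 s\<close>-th powers of the \<open>m\<close> symbols at \<open>n\<close>.  If \<open>\<Sum>n. \<bar>fourier f n\<bar>\<^sup>2 / T b n\<close> converges,
  then the functions with coefficients \<open>fourier f n * symbol ^ s / T b n\<close> solve the equation
  (\<open>is_diff_sum_of_summable\<close>).  Convergence for almost every \<open>b\<close> follows by integrating over the cube: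
  it suffices that \<open>1 / T b n\<close> has an integral bounded uniformly in \<open>n \<noteq> \<alpha>, \<beta>\<close>.  Each of the \<open>m\<close> summands is at
  most their sum, so \<open>T b n\<close> is at least the product of their \<open>m\<close>-th roots, and the integral
  is at most the \<open>m\<close>-th power of
  the integral of \<open>\<bar>symbol\<bar> powr (- 2 s / m)\<close> over a single circle.  By \<open>a b \<le> a\<^sup>2 + b\<^sup>2\<close> the two sine factors
  separate, and since \<open>b \<mapsto> p b\<close> preserves Lebesgue measure on the circle for every integer \<open>p \<noteq> 0\<close>,
  what remains is \<open>\<integral> \<bar>sin (b / 2)\<bar> powr (- 4 s / m)\<close>, which does not involve \<open>n\<close> and is finite because
  \<open>4 s < m\<close> (\<open>nn_integral_inverse_symbol_sum\<close>).  Hence for every \<open>s \<ge> 1\<close> the functions of the form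
  (iii) are exactly those with \<open>fourier f \<alpha> = fourier f \<beta> = 0\<close>, and these form a closed subspace
  because the coefficients are linear and continuous in \<open>f\<close>.
\<close>


section \<open>Square integrable functions on the circle\<close>

lemma space_circle: "space circle = {0..<2 * pi}"
  by (simp add: circle_def space_restrict_space)

lemma sets_circle_iff: "A \<in> sets circle \<longleftrightarrow> A \<in> sets borel \<and> A \<subseteq> {0..<2 * pi}"
  unfolding circle_def by (subst sets_restrict_space_iff) auto

lemma measurable_circle: "f \<in> borel_measurable borel \<Longrightarrow> f \<in> borel_measurable circle"
  unfolding circle_def by (rule measurable_restrict_space1) simp

lemma emeasure_circle: "A \<in> sets circle \<Longrightarrow> emeasure circle A = emeasure lborel A"
  unfolding circle_def by (subst emeasure_restrict_space) (auto simp: sets_restrict_space_iff)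

lemma emeasure_circle_space: "emeasure circle {0..<2 * pi} = ennreal (2 * pi)"
  by (subst emeasure_circle) (auto simp: sets_circle_iff)

interpretation circle: finite_measure circle
  by standard (simp add: space_circle emeasure_circle_space)

lemma measure_circle_space: "measure circle {0..<2 * pi} = 2 * pi"
  using emeasure_circle_space by (simp add: measure_def)

lemma finite_sets_circle: "finite A \<Longrightarrow> A \<subseteq> {0..<2 * pi} \<Longrightarrow> A \<in> sets circle"
  by (simp add: sets_circle_iff finite_imp_closed)

lemma L2_measurable [measurable_dest]: "f \<in> L2 \<Longrightarrow> f \<in> borel_measurable circle"
  by (simp add: L2_def)

lemma L2_integrable_power2: "f \<in> L2 \<Longrightarrow> integrable circle (\<lambda>t. (cmod (f t))\<^sup>2)"
  by (simp add: L2_def)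

lemma cmod_add_power2_le: "(cmod (x + y))\<^sup>2 \<le> 2 * (cmod x)\<^sup>2 + 2 * (cmod y)\<^sup>2"
proof -
  have "(cmod (x + y))\<^sup>2 \<le> (cmod x + cmod y)\<^sup>2"
    by (intro power_mono norm_triangle_ineq) auto
  also have "\<dots> \<le> 2 * (cmod x)\<^sup>2 + 2 * (cmod y)\<^sup>2"
    using sum_squares_bound[of "cmod x" "cmod y"] by (simp add: power2_sum)
  finally show ?thesis .
qed

lemma L2_dominated:
  assumes "f \<in> borel_measurable circle" "integrable circle h" "AE t in circle. (cmod (f t))\<^sup>2 \<le> h t"
  shows "f \<in> L2"
proof -
  note assms(1)[measurable]
  have "integrable circle (\<lambda>t. (cmod (f t))\<^sup>2)"
    by (rule Bochner_Integration.integrable_bound[OF assms(2)]) (use assms(3) in auto)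
  then show ?thesis using assms(1) by (simp add: L2_def)
qed

lemma L2_add: assumes "f \<in> L2" "g \<in> L2" shows "(\<lambda>t. f t + g t) \<in> L2"
proof (rule L2_dominated[where h = "\<lambda>t. 2 * (cmod (f t))\<^sup>2 + 2 * (cmod (g t))\<^sup>2"])
  show "(\<lambda>t. f t + g t) \<in> borel_measurable circle" using assms by measurable
qed (use assms[THEN L2_integrable_power2] cmod_add_power2_le in auto)

lemma L2_cmult: assumes "f \<in> L2" shows "(\<lambda>t. c * f t) \<in> L2"
proof (rule L2_dominated[where h = "\<lambda>t. (cmod c)\<^sup>2 * (cmod (f t))\<^sup>2"])
  show "(\<lambda>t. c * f t) \<in> borel_measurable circle" using assms by measurable
qed (use assms[THEN L2_integrable_power2] in \<open>auto simp: norm_mult power_mult_distrib\<close>)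

lemma L2_zero: "(\<lambda>t. 0) \<in> L2"
  by (simp add: L2_def)

lemma L2_diff: assumes "f \<in> L2" "g \<in> L2" shows "(\<lambda>t. f t - g t) \<in> L2"
  using L2_add[OF assms(1) L2_cmult[OF assms(2), of "-1"]] by simp

lemma L2_sum: "(\<And>i. i \<in> I \<Longrightarrow> f i \<in> L2) \<Longrightarrow> (\<lambda>t. \<Sum>i\<in>I. f i t) \<in> L2"
  by (induction I rule: infinite_finite_induct) (auto intro: L2_zero L2_add)

lemma L2_bounded:
  assumes "f \<in> borel_measurable circle" "\<And>t. cmod (f t) \<le> B"
  shows "f \<in> L2"
proof (rule L2_dominated[where h = "\<lambda>t. B\<^sup>2"])
  show "AE t in circle. (cmod (f t))\<^sup>2 \<le> B\<^sup>2" using assms(2) by (auto intro!: power_mono)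
qed (use assms(1) in auto)

lemma integrable_L2_mult:
  assumes "f \<in> L2" "g \<in> L2" shows "integrable circle (\<lambda>t. f t * g t)"
proof (rule Bochner_Integration.integrable_bound)
  show "integrable circle (\<lambda>t. (cmod (f t))\<^sup>2 + (cmod (g t))\<^sup>2)"
    using assms[THEN L2_integrable_power2] by auto
  show "(\<lambda>t. f t * g t) \<in> borel_measurable circle" using assms by measurable
  show "AE t in circle. norm (f t * g t) \<le> norm ((cmod (f t))\<^sup>2 + (cmod (g t))\<^sup>2)"
  proof (rule AE_I2)
    fix t
    have "2 * (cmod (f t) * cmod (g t)) \<le> (cmod (f t))\<^sup>2 + (cmod (g t))\<^sup>2"
      using sum_squares_bound[of "cmod (f t)" "cmod (g t)"] by simp
    moreover have "0 \<le> cmod (f t) * cmod (g t)" by simp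
    ultimately have "cmod (f t) * cmod (g t) \<le> (cmod (f t))\<^sup>2 + (cmod (g t))\<^sup>2" by linarith
    then show "norm (f t * g t) \<le> norm ((cmod (f t))\<^sup>2 + (cmod (g t))\<^sup>2)"
      by (simp add: norm_mult)
  qed
qed

lemma cis_measurable [measurable]: "cis \<in> borel_measurable borel"
  by (intro borel_measurable_continuous_onI continuous_intros)

lemma continuous_circle_measurable:
  "continuous_on UNIV f \<Longrightarrow> f \<in> borel_measurable circle" for f :: "real \<Rightarrow> 'a::topological_space"
  by (intro measurable_circle borel_measurable_continuous_onI)

lemma ident_measurable_circle: "(\<lambda>t. t) \<in> borel_measurable circle"
  by (rule measurable_circle) simp

lemma L2_cnj: "f \<in> L2 \<Longrightarrow> (\<lambda>t. cnj (f t)) \<in> L2"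
  unfolding L2_def
  by (auto intro!: borel_measurable_continuous_on[of cnj] continuous_intros)

lemma L2_cis: "(\<lambda>t. cis (c * t)) \<in> L2"
  by (rule L2_bounded[where B = 1]) (auto intro!: continuous_circle_measurable continuous_intros)

lemma L2_one: "(\<lambda>t. 1) \<in> L2"
  using L2_cis[of 0] by simp

lemma L2_integrable: "f \<in> L2 \<Longrightarrow> integrable circle f"
  using integrable_L2_mult[OF _ L2_one] by simp

lemma integrable_L2_cis: "f \<in> L2 \<Longrightarrow> integrable circle (\<lambda>t. f t * cis (- (of_int n * t)))"
  using integrable_L2_mult[OF _ L2_cis[of "- of_int n"]] by simp

subsection \<open>Fourier coefficients\<close>

lemma fourier_add:
  "f \<in> L2 \<Longrightarrow> g \<in> L2 \<Longrightarrow> fourier (\<lambda>t. f t + g t) n = fourier f n + fourier g n"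
  unfolding fourier_def
  by (simp add: distrib_right integrable_L2_cis Bochner_Integration.integral_add ring_distribs)

lemma fourier_cmult: "fourier (\<lambda>t. c * f t) n = c * fourier f n"
  unfolding fourier_def by (simp add: mult.assoc)

lemma fourier_diff:
  "f \<in> L2 \<Longrightarrow> g \<in> L2 \<Longrightarrow> fourier (\<lambda>t. f t - g t) n = fourier f n - fourier g n"
  using fourier_add[of f "\<lambda>t. (-1) * g t" n] fourier_cmult[of "-1" g n] L2_cmult[of g "-1"] by simp

lemma fourier_zero: "fourier (\<lambda>t. 0) n = 0"
  by (simp add: fourier_def)

lemma fourier_sum:
  "(\<And>i. i \<in> I \<Longrightarrow> f i \<in> L2) \<Longrightarrow> fourier (\<lambda>t. \<Sum>i\<in>I. f i t) n = (\<Sum>i\<in>I. fourier (f i) n)"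
proof (induction I rule: infinite_finite_induct)
  case (insert i I)
  then show ?case using fourier_add[of "f i" "\<lambda>t. \<Sum>i\<in>I. f i t" n] L2_sum[of I f] by simp
qed (auto simp: fourier_zero)

lemma fourier_cong_AE:
  assumes "f \<in> borel_measurable circle" "g \<in> borel_measurable circle" "AE t in circle. f t = g t"
  shows "fourier f n = fourier g n"
proof -
  have [measurable]: "f \<in> borel_measurable circle" "g \<in> borel_measurable circle"
    "(\<lambda>t. cis (- (of_int n * t))) \<in> borel_measurable circle"
    using assms by (auto intro!: continuous_circle_measurable continuous_intros)
  show ?thesis
    unfolding fourier_def
    by (intro arg_cong2[where f = "(*)"] refl integral_cong_AE) (use assms(3) in auto)
qed

lemma integral_cis_circle:
  "(LINT t|circle. cis (of_int k * t)) = (if k = 0 then 2 * pi else 0)"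
proof (cases "k = 0")
  case True
  then show ?thesis by (simp add: measure_circle_space space_circle scaleR_conv_of_real)
next
  case False
  define F where "F = (\<lambda>t::real. cis (of_int k * t) / (\<i> * of_int k))"
  have "(LINT t|circle. cis (of_int k * t)) = (LINT t:{0..<2*pi}|lborel. cis (of_int k * t))"
    unfolding circle_def set_lebesgue_integral_def by (subst integral_restrict_space) auto
  also have "\<dots> = (LINT t:{0..2*pi}|lborel. cis (of_int k * t))"
    unfolding set_lebesgue_integral_def
  proof (rule integral_cong_AE)
    show "AE t in lborel. indicator {0..<2*pi} t *\<^sub>R cis (of_int k * t)
            = indicator {0..2*pi} t *\<^sub>R cis (of_int k * t)"
      using AE_lborel_singleton[of "2*pi"] by eventually_elim (auto split: split_indicator)
  qed measurable
  also have "\<dots> = F (2*pi) - F 0"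
    unfolding set_lebesgue_integral_def
  proof (rule integral_FTC_Icc)
    fix x :: real
    show "(F has_vector_derivative cis (of_int k * x)) (at x within {0..2*pi})"
    proof -
      let ?G = "\<lambda>z. exp (\<i> * of_int k * z) / (\<i> * of_int k)"
      have "(?G has_field_derivative exp (\<i> * of_int k * of_real x)) (at (of_real x))"
        using False by (auto intro!: derivative_eq_intros simp: field_simps)
      from has_vector_derivative_real_field[OF this] show ?thesis
        by (simp add: F_def cis_conv_exp mult.assoc)
    qed
  qed (auto intro!: continuous_intros)
  also have "\<dots> = 0"
    using cis_multiple_2pi[of "of_int k"] by (simp add: F_def mult_ac)
  finally show ?thesis using False by simp
qed

lemma fourier_cis: "fourier (\<lambda>t. cis (of_int k * t)) n = (if k = n then 1 else 0)"
proof -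
  have "cis (of_int k * t) * cis (- (of_int n * t)) = cis (of_int (k - n) * t)" for t :: real
    by (simp add: cis_mult algebra_simps)
  then show ?thesis
    unfolding fourier_def by (simp only: integral_cis_circle) simp
qed

subsection \<open>Orthogonality of the characters and Bessel's inequality\<close>

lemma L2_trig: "(\<lambda>t. \<Sum>n\<in>A. c n * cis (of_int n * t)) \<in> L2" for A :: "int set"
  by (intro L2_sum L2_cmult L2_cis)

lemma fourier_trig:
  assumes "finite A"
  shows "fourier (\<lambda>t. \<Sum>n\<in>A. c n * cis (of_int n * t)) k = (if k \<in> A then c k else 0)"
proof -
  have "fourier (\<lambda>t. \<Sum>n\<in>A. c n * cis (of_int n * t)) k = (\<Sum>n\<in>A. c n * (if n = k then 1 else 0))"
    by (subst fourier_sum) (auto intro!: L2_cmult L2_cis simp: fourier_cmult fourier_cis)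
  then show ?thesis using assms by (simp add: sum.delta' if_distrib cong: if_cong)
qed

lemma integral_mult_cnj_trig:
  assumes "g \<in> L2"
  shows "(LINT t|circle. g t * cnj (\<Sum>n\<in>A. c n * cis (of_int n * t)))
           = 2 * pi * (\<Sum>n\<in>A. cnj (c n) * fourier g n)"
proof -
  have "(LINT t|circle. g t * cnj (\<Sum>n\<in>A. c n * cis (of_int n * t)))
      = (LINT t|circle. (\<Sum>n\<in>A. cnj (c n) * (g t * cis (- (of_int n * t)))))"
    by (intro arg_cong2[where f = lebesgue_integral] refl ext)
       (simp add: cis_cnj sum_distrib_left mult_ac)
  also have "\<dots> = (\<Sum>n\<in>A. cnj (c n) * (LINT t|circle. g t * cis (- (of_int n * t))))"
    using integrable_L2_cis[OF assms] by (subst Bochner_Integration.integral_sum) auto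
  also have "\<dots> = 2 * pi * (\<Sum>n\<in>A. cnj (c n) * fourier g n)"
    by (simp add: fourier_def sum_distrib_left)
  finally show ?thesis .
qed

lemma cnj_mult_self: "cnj z * z = complex_of_real ((cmod z)\<^sup>2)"
  by (simp only: complex_norm_square mult.commute)

lemma norm_trig:
  fixes A :: "int set"
  assumes "finite A"
  shows "(LINT t|circle. (cmod (\<Sum>n\<in>A. c n * cis (of_int n * t)))\<^sup>2) = 2 * pi * (\<Sum>n\<in>A. (cmod (c n))\<^sup>2)"
proof -
  let ?S = "\<lambda>t::real. \<Sum>n\<in>A. c n * cis (of_int n * t)"
  have "complex_of_real (LINT t|circle. (cmod (?S t))\<^sup>2) = (LINT t|circle. ?S t * cnj (?S t))"
    by (simp only: complex_norm_square integral_complex_of_real[symmetric])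
  also have "\<dots> = 2 * pi * (\<Sum>n\<in>A. cnj (c n) * fourier ?S n)"
    by (rule integral_mult_cnj_trig[OF L2_trig])
  also have "\<dots> = complex_of_real (2 * pi * (\<Sum>n\<in>A. (cmod (c n))\<^sup>2))"
    by (simp only: of_real_mult of_real_sum of_real_numeral)
       (intro arg_cong2[where f = "(*)"] refl sum.cong, auto simp: fourier_trig[OF assms] cnj_mult_self simp del: of_real_power)
  finally show ?thesis by (simp only: of_real_eq_iff)
qed

lemma integral_cmod_diff_power2:
  assumes "f \<in> L2" "g \<in> L2"
  shows "(LINT t|circle. (cmod (f t - g t))\<^sup>2)
    = (LINT t|circle. (cmod (f t))\<^sup>2) - 2 * (LINT t|circle. Re (f t * cnj (g t))) + (LINT t|circle. (cmod (g t))\<^sup>2)"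
proof -
  have *: "(cmod (x - y))\<^sup>2 = (cmod x)\<^sup>2 - 2 * Re (x * cnj y) + (cmod y)\<^sup>2" for x y
    by (simp add: cmod_power2 power2_diff)
  have "integrable circle (\<lambda>t. 2 * Re (f t * cnj (g t)))"
    using integrable_L2_mult[OF assms(1) L2_cnj[OF assms(2)]]
    by (intro integrable_mult_right integrable_Re)
  then show ?thesis
    unfolding * using assms[THEN L2_integrable_power2]
    by (simp only: Bochner_Integration.integral_add Bochner_Integration.integral_diff
      Bochner_Integration.integrable_diff integral_mult_right_zero)
qed

lemma bessel_inequality:
  assumes "f \<in> L2" "finite A"
  shows "2 * pi * (\<Sum>n\<in>A. (cmod (fourier f n))\<^sup>2) \<le> (LINT t|circle. (cmod (f t))\<^sup>2)"
proof -
  let ?c = "fourier f"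
  let ?S = "\<lambda>t::real. \<Sum>n\<in>A. ?c n * cis (of_int n * t)"
  let ?B = "\<Sum>n\<in>A. (cmod (?c n))\<^sup>2"
  have S: "?S \<in> L2" by (rule L2_trig)
  have "(LINT t|circle. Re (f t * cnj (?S t))) = Re (LINT t|circle. f t * cnj (?S t))"
    by (rule integral_Re[OF integrable_L2_mult[OF assms(1) L2_cnj[OF S]]])
  also have "\<dots> = Re (complex_of_real (2 * pi * ?B))"
    unfolding integral_mult_cnj_trig[OF assms(1)]
    by (simp only: cnj_mult_self of_real_mult of_real_sum of_real_numeral)
  finally have cross: "(LINT t|circle. Re (f t * cnj (?S t))) = 2 * pi * ?B" by simp
  have "0 \<le> (LINT t|circle. (cmod (f t - ?S t))\<^sup>2)" by simp
  also have "\<dots> = (LINT t|circle. (cmod (f t))\<^sup>2) - 2 * (2 * pi * ?B) + 2 * pi * ?B"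
    unfolding integral_cmod_diff_power2[OF assms(1) S] norm_trig[OF assms(2)] cross ..
  finally show ?thesis by simp
qed

lemma fourier_summable:
  assumes "f \<in> L2" shows "(\<lambda>n. (cmod (fourier f n))\<^sup>2) summable_on UNIV"
proof (rule nonneg_bdd_above_summable_on)
  show "bdd_above (sum (\<lambda>n. (cmod (fourier f n))\<^sup>2) ` {F. F \<subseteq> UNIV \<and> finite F})"
    using bessel_inequality[OF assms]
    by (intro bdd_aboveI[where M = "(LINT t|circle. (cmod (f t))\<^sup>2) / (2 * pi)"])
       (auto simp: field_simps)
qed auto

text \<open>The sharp bound has the factor \<open>1 / sqrt (2 * pi)\<close>; continuity of the coefficients is all that
  matters here.\<close>

lemma fourier_le_norm:
  assumes "f \<in> L2" shows "cmod (fourier f n) \<le> L2_norm f"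
proof -
  have "(cmod (fourier f n))\<^sup>2 \<le> 2 * pi * (cmod (fourier f n))\<^sup>2"
    using mult_right_mono[of 1 "2 * pi" "(cmod (fourier f n))\<^sup>2"] pi_gt3 by simp
  also have "\<dots> \<le> (LINT t|circle. (cmod (f t))\<^sup>2)"
    using bessel_inequality[OF assms, of "{n}"] by simp
  finally show ?thesis unfolding L2_norm_def by (rule real_le_rsqrt)
qed

subsection \<open>Fourier coefficients determine the function\<close>

lemma L2_mult_cis: "u \<in> L2 \<Longrightarrow> (\<lambda>t. u t * cis (c * t)) \<in> L2"
  using L2_measurable[OF L2_cis[of c]] unfolding L2_def by (auto simp: norm_mult)

lemma fourier_mult_cis: "fourier (\<lambda>t. u t * cis (of_int k * t)) n = fourier u (n - k)"
  unfolding fourier_def by (simp add: mult.assoc cis_mult algebra_simps)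

text \<open>Multiplying by a character shifts the coefficients, so vanishing of all of them survives
  multiplication by real polynomials in \<open>cis t\<close>.  The function \<open>u\<close> varies in the induction: a product
  \<open>p * q\<close> is treated by multiplying with \<open>p\<close> first and applying the hypothesis for \<open>q\<close> to the result.\<close>

lemma fourier_mult_polynomial:
  assumes "real_polynomial_function p" "u \<in> L2" "\<And>n. fourier u n = 0"
  shows "(\<lambda>t. u t * complex_of_real (p (cis t))) \<in> L2 \<and>
         (\<forall>n. fourier (\<lambda>t. u t * complex_of_real (p (cis t))) n = 0)"
  using assms
proof (induction p arbitrary: u rule: real_polynomial_function.induct)
  case (linear p)
  interpret p: bounded_linear p by fact
  have p: "p (cis t) = cos t * p 1 + sin t * p \<i>" for t
  proof -
    have "cis t = cos t *\<^sub>R 1 + sin t *\<^sub>R \<i>" by (simp add: complex_eq_iff)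
    then have "p (cis t) = p (cos t *\<^sub>R 1 + sin t *\<^sub>R \<i>)" by simp
    then show ?thesis by (simp only: p.add p.scaleR real_scaleR_def)
  qed
  define a where "a = (of_real (p 1) - \<i> * of_real (p \<i>)) / 2"
  define b where "b = (of_real (p 1) + \<i> * of_real (p \<i>)) / 2"
  have eq: "(\<lambda>t. u t * complex_of_real (p (cis t)))
     = (\<lambda>t. a * (u t * cis (of_int 1 * t)) + b * (u t * cis (of_int (-1) * t)))"
    by (rule ext) (simp add: p a_def b_def complex_eq_iff field_simps)
  have L: "(\<lambda>t. u t * cis (of_int k * t)) \<in> L2" for k
    by (rule L2_mult_cis[OF linear(2)])
  show ?case unfolding eq
    by (intro conjI allI L2_add L2_cmult L)
       (simp only: fourier_add L L2_cmult fourier_cmult fourier_mult_cis linear(3), simp)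
next
  case (const c)
  then show ?case using L2_cmult[OF const(1), of c] fourier_cmult[of c u] by (simp add: mult.commute)
next
  case (add p q)
  show ?case
    using add.IH(1)[OF add.prems] add.IH(2)[OF add.prems]
    by (auto simp: distrib_left fourier_add intro!: L2_add)
next
  case (mult p q)
  show ?case
    using mult.IH(2)[of "\<lambda>t. u t * complex_of_real (p (cis t))"] mult.IH(1)[OF mult.prems]
    by (simp add: mult.assoc)
qed

text \<open>By the Weierstrass approximation theorem on the unit circle, a continuous function of \<open>cis t\<close> is a
  uniform limit of trigonometric polynomials.\<close>

lemma integral_mult_continuous_eq_0:
  assumes f: "f \<in> L2" "\<And>n. fourier f n = 0" and g: "continuous_on (sphere 0 1) g"
  shows "(LINT t|circle. f t * complex_of_real (g (cis t))) = 0"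
proof -
  let ?C = "LINT t|circle. cmod (f t)"
  have gm [measurable]: "(\<lambda>t. g (cis t)) \<in> borel_measurable circle"
    by (intro continuous_circle_measurable continuous_on_compose2[OF g] continuous_intros) auto
  have fi: "integrable circle f" by (rule L2_integrable[OF f(1)])
  note [measurable] = L2_measurable[OF f(1)]
  obtain B where B: "\<And>t. \<bar>g (cis t)\<bar> \<le> B"
  proof -
    have "compact (g ` sphere 0 1)" by (intro compact_continuous_image g) auto
    then have "bounded (g ` sphere 0 1)" by (rule compact_imp_bounded)
    then obtain B where "\<forall>x\<in>g ` sphere 0 1. norm x \<le> B" unfolding bounded_iff by blast
    then show ?thesis by (intro that[of B]) auto
  qed
  have fgi: "integrable circle (\<lambda>t. f t * complex_of_real (g (cis t)))"
  proof (rule Bochner_Integration.integrable_bound)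
    show "integrable circle (\<lambda>t. B * cmod (f t))" using fi by auto
    have "cmod (f t) * \<bar>g (cis t)\<bar> \<le> cmod (f t) * \<bar>B\<bar>" for t
      by (intro mult_left_mono order_trans[OF B abs_ge_self]) auto
    then show "AE t in circle. norm (f t * complex_of_real (g (cis t))) \<le> norm (B * cmod (f t))"
      by (intro AE_I2) (simp add: norm_mult abs_mult mult.commute)
  qed measurable
  have bound: "cmod (LINT t|circle. f t * complex_of_real (g (cis t))) \<le> e * ?C" if e: "e > 0" for e
  proof -
    obtain p where p: "real_polynomial_function p" "\<And>x. x \<in> sphere 0 1 \<Longrightarrow> \<bar>g x - p x\<bar> < e"
      using Stone_Weierstrass_real_polynomial_function[OF compact_sphere g e] by blast
    note fp = fourier_mult_polynomial[OF p(1) f]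
    have fpi: "integrable circle (\<lambda>t. f t * complex_of_real (p (cis t)))"
      using fp L2_integrable by blast
    have "(LINT t|circle. f t * complex_of_real (p (cis t))) = 0"
      using fp[THEN conjunct2, rule_format, of 0] by (simp add: fourier_def)
    then have "(LINT t|circle. f t * complex_of_real (g (cis t)))
        = (LINT t|circle. f t * complex_of_real (g (cis t)) - f t * complex_of_real (p (cis t)))"
      using fgi fpi by (simp add: Bochner_Integration.integral_diff)
    also have "cmod \<dots> \<le> (LINT t|circle. e * cmod (f t))"
    proof (rule Bochner_Integration.integral_norm_bound_integral)
      fix t
      have "\<bar>g (cis t) - p (cis t)\<bar> \<le> e" using p(2)[of "cis t"] by simp
      then have "cmod (f t) * \<bar>g (cis t) - p (cis t)\<bar> \<le> cmod (f t) * e"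
        by (intro mult_left_mono) auto
      moreover have "f t * complex_of_real (g (cis t)) - f t * complex_of_real (p (cis t))
          = f t * complex_of_real (g (cis t) - p (cis t))"
        by (simp add: algebra_simps)
      ultimately show "norm (f t * complex_of_real (g (cis t)) - f t * complex_of_real (p (cis t))) \<le> e * cmod (f t)"
        by (simp only: norm_mult norm_of_real mult.commute)
    qed (use fgi fpi fi in auto)
    finally show ?thesis by simp
  qed
  have "cmod (LINT t|circle. f t * complex_of_real (g (cis t))) \<le> 0"
  proof (rule field_le_epsilon)
    fix e :: real assume "e > 0"
    have C: "?C \<ge> 0" by simp
    have "e / (?C + 1) > 0" using C \<open>e > 0\<close> by (intro divide_pos_pos) linarith+
    then have "cmod (LINT t|circle. f t * complex_of_real (g (cis t))) \<le> e / (?C + 1) * ?C"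
      by (rule bound)
    also have "\<dots> \<le> e / (?C + 1) * (?C + 1)"
      using C \<open>e > 0\<close> by (intro mult_left_mono divide_nonneg_nonneg) linarith+
    also have "\<dots> = e" using C by (simp add: add_nonneg_eq_0_iff)
    finally show "cmod (LINT t|circle. f t * complex_of_real (g (cis t))) \<le> 0 + e" by simp
  qed
  then show ?thesis by simp
qed

lemma cis_mem_arc_iff:
  assumes "t \<in> {0..<2 * pi}" "x < 2 * pi"
  shows "cis t \<in> cis ` {0..x} \<longleftrightarrow> t \<in> {0..x}"
proof
  assume "cis t \<in> cis ` {0..x}"
  then obtain s where s: "cis t = cis s" "0 \<le> s" "s \<le> x" by auto
  then have "sin t = sin s" "cos t = cos s" by (metis cis.sel)+
  then obtain n :: int where n: "t = s + 2 * pi * n" using sin_cos_eq_iff by metis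
  have "n = 0"
  proof (rule ccontr)
    assume "n \<noteq> 0"
    then have "2 * pi * 1 \<le> 2 * pi * \<bar>real_of_int n\<bar>" by (intro mult_left_mono) auto
    then have "2 * pi \<le> \<bar>t - s\<bar>" using n by (simp add: abs_mult)
    then show False using assms s by auto
  qed
  then show "t \<in> {0..x}" using n s by simp
qed auto

text \<open>The indicator of an arc is a pointwise limit of continuous functions of \<open>cis t\<close>.\<close>

lemma integral_indicator_eq_0:
  assumes f: "f \<in> L2" "\<And>n. fourier f n = 0"
  shows "(LINT t|circle. f t * indicator {x<..} t) = 0"
proof -
  note [measurable] = L2_measurable[OF f(1)] ident_measurable_circle
  have f0: "(LINT t|circle. f t) = 0" using f(2)[of 0] by (simp add: fourier_def)
  consider "x < 0" | "0 \<le> x" "x < 2 * pi" | "x \<ge> 2 * pi" by linarith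
  then show ?thesis
  proof cases
    case 1
    then have "(LINT t|circle. f t * indicator {x<..} t) = (LINT t|circle. f t)"
      by (intro Bochner_Integration.integral_cong) (auto simp: space_circle)
    then show ?thesis using f0 by simp
  next
    case 3
    then have "(LINT t|circle. f t * indicator {x<..} t) = (LINT t|circle. 0)"
      by (intro Bochner_Integration.integral_cong) (auto simp: space_circle)
    then show ?thesis by simp
  next
    case 2
    define C where "C = cis ` {0..x}"
    define g where "g = (\<lambda>(k::nat) z. max 0 (1 - real k * infdist z C))"
    have C: "compact C" "C \<noteq> {}"
      using 2 by (auto simp: C_def intro!: compact_continuous_image continuous_intros)
    have gc: "continuous_on S (g k)" for k S
      unfolding g_def by (intro continuous_intros)
    have lim: "(\<lambda>k. g k z) \<longlonglongrightarrow> indicator C z" for z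
    proof (cases "z \<in> C")
      case True
      then show ?thesis by (simp add: g_def)
    next
      case False
      then have pos: "infdist z C > 0"
        using C by (metis compact_imp_closed in_closed_iff_infdist_zero infdist_nonneg less_eq_real_def)
      obtain N :: nat where N: "1 / infdist z C < N" using reals_Archimedean2 by blast
      have "g k z = 0" if "k \<ge> N" for k
      proof -
        have "1 / infdist z C < k" using N that by linarith
        then show ?thesis using pos by (simp add: g_def field_simps)
      qed
      then have "eventually (\<lambda>k. g k z = 0) sequentially" by (auto simp: eventually_sequentially)
      then show ?thesis using False by (simp add: tendsto_eventually)
    qed
    have "(\<lambda>k. LINT t|circle. f t * complex_of_real (g k (cis t)))
            \<longlonglongrightarrow> (LINT t|circle. f t * complex_of_real (indicator C (cis t)))"
    proof (rule integral_dominated_convergence[where w = "\<lambda>t. cmod (f t)"])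
      have "C \<in> sets borel" using C by (intro borel_closed compact_imp_closed)
      then have "(\<lambda>t. indicator C (cis t) :: real) \<in> borel_measurable borel" by measurable
      then show "(\<lambda>t. f t * complex_of_real (indicator C (cis t))) \<in> borel_measurable circle"
        by measurable
      show "(\<lambda>t. f t * complex_of_real (g k (cis t))) \<in> borel_measurable circle" for k
      proof -
        have "(\<lambda>t. g k (cis t)) \<in> borel_measurable circle"
          by (intro continuous_circle_measurable continuous_on_compose2[OF gc[of UNIV]] continuous_intros) auto
        then show ?thesis by measurable
      qed
      show "integrable circle (\<lambda>t. cmod (f t))" using L2_integrable[OF f(1)] by simp
      show "AE t in circle. (\<lambda>k. f t * complex_of_real (g k (cis t))) \<longlonglongrightarrow> f t * complex_of_real (indicator C (cis t))"
        by (intro AE_I2 tendsto_intros lim)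
      have "\<bar>g k z\<bar> \<le> 1" for k z by (auto simp: g_def infdist_nonneg)
      then show "AE t in circle. norm (f t * complex_of_real (g k (cis t))) \<le> cmod (f t)" for k
        by (intro AE_I2) (auto simp: norm_mult intro: mult_left_le)
    qed
    then have "(LINT t|circle. f t * complex_of_real (indicator C (cis t))) = 0"
      using integral_mult_continuous_eq_0[OF f gc] by (simp add: LIMSEQ_const_iff)
    also have "(LINT t|circle. f t * complex_of_real (indicator C (cis t)))
        = (LINT t|circle. f t - f t * indicator {x<..} t)"
      using 2 by (intro Bochner_Integration.integral_cong)
        (auto simp: space_circle C_def indicator_def cis_mem_arc_iff simp del: image_iff)
    also have "\<dots> = (LINT t|circle. f t) - (LINT t|circle. f t * indicator {x<..} t)"
    proof (rule Bochner_Integration.integral_diff)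
      show "integrable circle (\<lambda>t. f t * indicator {x<..} t)"
        by (rule Bochner_Integration.integrable_bound[OF L2_integrable[OF f(1)]])
           (auto simp: indicator_def)
    qed (rule L2_integrable[OF f(1)])
    finally show ?thesis using f0 by simp
  qed
qed

text \<open>The densities given by the positive and negative parts of \<open>h\<close> define finite measures that agree on
  all half lines, hence are equal.\<close>

lemma AE_eq_0_of_integral_greaterThan:
  fixes h :: "real \<Rightarrow> real"
  assumes h: "integrable circle h" and z: "\<And>x. (LINT t|circle. h t * indicator {x<..} t) = 0"
  shows "AE t in circle. h t = 0"
proof -
  note [measurable] = borel_measurable_integrable[OF h]
  let ?P = "density circle (\<lambda>t. ennreal (h t))" and ?N = "density circle (\<lambda>t. ennreal (- h t))"
  note ident_measurable_circle [measurable]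
  have hi: "integrable circle (\<lambda>t. max 0 (h t) * indicator {x<..} t)"
       "integrable circle (\<lambda>t. max 0 (- h t) * indicator {x<..} t)" for x
    by (rule Bochner_Integration.integrable_bound[OF h]; auto simp: indicator_def)+
  have P: "(\<integral>\<^sup>+t. ennreal (h t) * indicator {x<..} t \<partial>circle)
      = ennreal (LINT t|circle. max 0 (h t) * indicator {x<..} t)" for x
    by (subst nn_integral_eq_integral[OF hi(1), symmetric])
       (auto simp: indicator_def max_def ennreal_neg intro!: nn_integral_cong)
  have N: "(\<integral>\<^sup>+t. ennreal (- h t) * indicator {x<..} t \<partial>circle)
      = ennreal (LINT t|circle. max 0 (- h t) * indicator {x<..} t)" for x
    by (subst nn_integral_eq_integral[OF hi(2), symmetric])
       (auto simp: indicator_def max_def ennreal_neg intro!: nn_integral_cong)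
  have diff: "(LINT t|circle. max 0 (h t) * indicator {x<..} t) - (LINT t|circle. max 0 (- h t) * indicator {x<..} t)
     = (LINT t|circle. h t * indicator {x<..} t)" for x
    by (subst Bochner_Integration.integral_diff[OF hi, symmetric])
       (auto simp: max_def indicator_def intro!: Bochner_Integration.integral_cong)
  have eq: "(\<integral>\<^sup>+t. ennreal (h t) * indicator {x<..} t \<partial>circle)
      = (\<integral>\<^sup>+t. ennreal (- h t) * indicator {x<..} t \<partial>circle)" for x
    using z[of x] diff[of x] by (simp add: P N)
  have em: "emeasure (distr (density circle d) borel (\<lambda>t. t)) B = (\<integral>\<^sup>+t. d t * indicator B t \<partial>circle)"
    if [measurable]: "d \<in> borel_measurable circle" "B \<in> sets borel" for d B
  proof -
    have "emeasure (distr (density circle d) borel (\<lambda>t. t)) B = emeasure (density circle d) (B \<inter> space circle)"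
      by (subst emeasure_distr) auto
    also have "\<dots> = (\<integral>\<^sup>+t. d t * indicator (B \<inter> space circle) t \<partial>circle)"
      using measurable_sets[OF ident_measurable_circle that(2)] by (subst emeasure_density) auto
    also have "\<dots> = (\<integral>\<^sup>+t. d t * indicator B t \<partial>circle)"
      by (intro nn_integral_cong) (auto simp: indicator_def)
    finally show ?thesis .
  qed
  have "distr ?P borel (\<lambda>t. t) = distr ?N borel (\<lambda>t. t)"
  proof (rule measure_eqI_lessThan)
    fix x :: real
    show "emeasure (distr ?P borel (\<lambda>t. t)) {x<..} < \<infinity>" by (simp add: em P)
    show "emeasure (distr ?P borel (\<lambda>t. t)) {x<..} = emeasure (distr ?N borel (\<lambda>t. t)) {x<..}"
      by (simp add: em eq)
  qed auto
  then have "(\<integral>\<^sup>+t. ennreal (h t) * indicator B t \<partial>circle) = (\<integral>\<^sup>+t. ennreal (- h t) * indicator B t \<partial>circle)"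
    if "B \<in> sets circle" for B
    using that by (subst (1 2) em[symmetric]) (auto simp: sets_circle_iff)
  then have "AE t in circle. ennreal (h t) = ennreal (- h t)"
    by (intro circle.density_unique2) measurable
  then show ?thesis
  proof eventually_elim
    case (elim t)
    then show ?case
      by (metis antisym ennreal_eq_0_iff ennreal_neg neg_0_le_iff_le neg_le_0_iff_le linear)
  qed
qed

lemma fourier_eq_0_imp_AE:
  assumes f: "f \<in> L2" "\<And>n. fourier f n = 0"
  shows "AE t in circle. f t = 0"
proof -
  note [measurable] = L2_measurable[OF f(1)]
  note ident_measurable_circle [measurable]
  have i: "integrable circle (\<lambda>t. f t * indicator {x<..} t)" for x
    by (rule Bochner_Integration.integrable_bound[OF L2_integrable[OF f(1)]]) (auto simp: indicator_def)
  have "(LINT t|circle. Re (f t) * indicator {x<..} t) = Re (LINT t|circle. f t * indicator {x<..} t)" for x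
    by (subst integral_Re[OF i, symmetric]) (auto simp: indicator_def intro!: Bochner_Integration.integral_cong)
  then have "AE t in circle. Re (f t) = 0"
    using L2_integrable[OF f(1)] integral_indicator_eq_0[OF f]
    by (intro AE_eq_0_of_integral_greaterThan) auto
  moreover
  have "(LINT t|circle. Im (f t) * indicator {x<..} t) = Im (LINT t|circle. f t * indicator {x<..} t)" for x
    by (subst integral_Im[OF i, symmetric]) (auto simp: indicator_def intro!: Bochner_Integration.integral_cong)
  then have "AE t in circle. Im (f t) = 0"
    using L2_integrable[OF f(1)] integral_indicator_eq_0[OF f]
    by (intro AE_eq_0_of_integral_greaterThan) auto
  ultimately show ?thesis by eventually_elim (simp add: complex_eq_iff)
qed

lemma fourier_eq_imp_AE:
  assumes "f \<in> L2" "g \<in> L2" "\<And>n. fourier f n = fourier g n"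
  shows "AE t in circle. f t = g t"
proof -
  have "AE t in circle. f t - g t = 0"
    using assms by (intro fourier_eq_0_imp_AE L2_diff) (auto simp: fourier_diff)
  then show ?thesis by simp
qed

subsection \<open>Every square summable family is a family of Fourier coefficients\<close>

text \<open>The Cauchy-Schwarz inequality with geometric weights.\<close>

lemma square_sum_le_weighted:
  fixes a :: "nat \<Rightarrow> real"
  assumes "\<And>k. a k \<ge> 0"
  shows "(\<Sum>k<n. a k)\<^sup>2 \<le> 2 * (\<Sum>k<n. 2 ^ k * (a k)\<^sup>2)"
proof -
  have "(\<Sum>k<n. a k)\<^sup>2 = (\<Sum>k<n. sqrt ((1/2) ^ k) * (sqrt (2 ^ k) * a k))\<^sup>2"
    by (intro arg_cong[where f = "\<lambda>x. x\<^sup>2"] sum.cong refl)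
       (simp flip: mult.assoc real_sqrt_mult power_mult_distrib)
  also have "\<dots> \<le> (\<Sum>k<n. (sqrt ((1/2) ^ k))\<^sup>2) * (\<Sum>k<n. (sqrt (2 ^ k) * a k)\<^sup>2)"
    by (rule Cauchy_Schwarz_ineq_sum)
  also have "\<dots> = (\<Sum>k<n. (1/2::real) ^ k) * (\<Sum>k<n. 2 ^ k * (a k)\<^sup>2)"
    by (simp add: power_mult_distrib)
  also have "\<dots> \<le> 2 * (\<Sum>k<n. 2 ^ k * (a k)\<^sup>2)"
  proof (rule mult_right_mono)
    have "(\<Sum>k<n. (1/2::real) ^ k) \<le> (\<Sum>k. (1/2) ^ k)"
      by (rule sum_le_suminf) (auto intro: summable_geometric)
    then show "(\<Sum>k<n. (1/2::real) ^ k) \<le> 2" by (simp add: suminf_geometric)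
  qed (auto intro: sum_nonneg)
  finally show ?thesis .
qed

text \<open>The part of the completeness of \<open>L2\<close> that is needed: if consecutive terms approach each other
  geometrically in mean square, the sequence converges almost everywhere and is dominated by a square
  integrable function, so the Fourier coefficients converge to those of the limit.\<close>

lemma L2_limit_of_rapid_sequence:
  fixes S :: "nat \<Rightarrow> real \<Rightarrow> complex"
  assumes S: "\<And>k. S k \<in> L2"
    and d: "\<And>k. (LINT t|circle. (cmod (S (Suc k) t - S k t))\<^sup>2) \<le> C * (1/4) ^ k"
  shows "\<exists>g\<in>L2. \<forall>n. (\<lambda>k. fourier (S k) n) \<longlonglongrightarrow> fourier g n"
proof -
  note [measurable] = L2_measurable[OF S]
  define D where "D = (\<lambda>k t. (cmod (S (Suc k) t - S k t))\<^sup>2)"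
  define h where "h = (\<lambda>k t. 2 ^ k * D k t)"
  have hi: "integrable circle (h k)" for k
    using L2_integrable_power2[OF L2_diff[OF S S]] unfolding h_def D_def by simp
  have hnn: "h k t \<ge> 0" for k t by (simp add: h_def D_def)
  have hint: "(LINT t|circle. h k t) \<le> C * (1/2) ^ k" for k
  proof -
    have "(LINT t|circle. h k t) = 2 ^ k * (LINT t|circle. D k t)" by (simp add: h_def)
    also have "\<dots> \<le> 2 ^ k * (C * (1/4) ^ k)" using d[of k] by (intro mult_left_mono) (auto simp: D_def)
    also have "\<dots> = C * (2 * (1/4)) ^ k" by (simp only: power_mult_distrib mult_ac)
    finally show ?thesis by simp
  qed
  have sum_int: "summable (\<lambda>k. LINT t|circle. norm (h k t))"
  proof (rule summable_comparison_test')
    show "summable (\<lambda>k. C * (1/2) ^ k)" by (intro summable_mult summable_geometric) auto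
    show "norm (LINT t|circle. norm (h k t)) \<le> C * (1/2) ^ k" for k
      using hint[of k] hnn by simp
  qed
  define H where "H = (\<lambda>t. \<Sum>k. h k t)"
  have "(\<Sum>k. \<integral>\<^sup>+t. ennreal (h k t) \<partial>circle) \<noteq> \<infinity>"
  proof -
    have "(\<integral>\<^sup>+t. ennreal (h k t) \<partial>circle) = ennreal (LINT t|circle. norm (h k t))" for k
      using hnn by (subst nn_integral_eq_integral[OF hi]) auto
    then show ?thesis by (simp only:) (subst suminf_ennreal2[OF _ sum_int], auto)
  qed
  then have "(\<integral>\<^sup>+t. (\<Sum>k. ennreal (h k t)) \<partial>circle) \<noteq> \<infinity>"
    using borel_measurable_integrable[OF hi] by (subst nn_integral_suminf) auto
  then have "AE t in circle. (\<Sum>k. ennreal (h k t)) \<noteq> \<infinity>"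
    using borel_measurable_integrable[OF hi] by (intro nn_integral_noteq_infinite) auto
  then have hsum: "AE t in circle. summable (\<lambda>k. h k t)"
    by eventually_elim (use hnn in \<open>auto intro: summable_suminf_not_top\<close>)
  have Hi: "integrable circle H"
    unfolding H_def using hsum sum_int hnn
    by (intro integrable_suminf hi) auto
  note [measurable] = borel_measurable_integrable[OF Hi]
  define W where "W = (\<lambda>t. sqrt (2 * (cmod (S 0 t))\<^sup>2 + 4 * H t))"
  have bound: "cmod (S n t) \<le> W t" if "summable (\<lambda>k. h k t)" for n t
  proof -
    have "S n t = S 0 t + (\<Sum>k<n. S (Suc k) t - S k t)"
      using sum_lessThan_telescope[of "\<lambda>k. S k t" n] by simp
    then have "(cmod (S n t))\<^sup>2 \<le> 2 * (cmod (S 0 t))\<^sup>2 + 2 * (cmod (\<Sum>k<n. S (Suc k) t - S k t))\<^sup>2"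
      by (simp only: cmod_add_power2_le)
    also have "(cmod (\<Sum>k<n. S (Suc k) t - S k t))\<^sup>2 \<le> (\<Sum>k<n. cmod (S (Suc k) t - S k t))\<^sup>2"
      by (intro power_mono norm_sum) auto
    also have "\<dots> \<le> 2 * (\<Sum>k<n. h k t)"
      unfolding h_def D_def by (rule square_sum_le_weighted) auto
    also have "(\<Sum>k<n. h k t) \<le> H t"
      unfolding H_def using that hnn by (intro sum_le_suminf) auto
    finally show ?thesis unfolding W_def by (intro real_le_rsqrt) simp
  qed
  have conv: "convergent (\<lambda>n. S n t)" if t: "summable (\<lambda>k. h k t)" for t
  proof -
    have "summable (\<lambda>k. norm (S (Suc k) t - S k t))"
    proof (rule bounded_imp_summable)
      fix n
      have "(\<Sum>k<Suc n. cmod (S (Suc k) t - S k t))\<^sup>2 \<le> 2 * (\<Sum>k<Suc n. h k t)"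
        unfolding h_def D_def by (rule square_sum_le_weighted) auto
      also have "(\<Sum>k<Suc n. h k t) \<le> H t"
        unfolding H_def using t hnn by (intro sum_le_suminf) auto
      finally show "(\<Sum>k\<le>n. norm (S (Suc k) t - S k t)) \<le> sqrt (2 * H t)"
        by (intro real_le_rsqrt) (simp add: lessThan_Suc_atMost)
    qed auto
    then have "summable (\<lambda>k. S (Suc k) t - S k t)" by (rule summable_norm_cancel)
    then have "convergent (\<lambda>n. \<Sum>k<n. S (Suc k) t - S k t)" by (simp add: summable_iff_convergent)
    then have "convergent (\<lambda>n. S n t - S 0 t)"
      by (simp add: sum_lessThan_telescope[of "\<lambda>k. S k t"])
    then have "convergent (\<lambda>n. S n t - S 0 t + S 0 t)" by (intro convergent_add convergent_const)
    then show ?thesis by simp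
  qed
  \<comment> \<open>Off the null set the sequence converges and is dominated by the square integrable \<open>W\<close>.\<close>
  define g where "g = (\<lambda>t. lim (\<lambda>n. S n t))"
  have gm [measurable]: "g \<in> borel_measurable circle"
    unfolding g_def by (intro borel_measurable_lim_metric) measurable
  have lim: "(\<lambda>n. S n t) \<longlonglongrightarrow> g t" if "summable (\<lambda>k. h k t)" for t
    using conv[OF that] by (simp add: g_def convergent_LIMSEQ_iff)
  have W2: "(\<lambda>t. complex_of_real (W t)) \<in> L2"
  proof (rule L2_dominated[where h = "\<lambda>t. 2 * (cmod (S 0 t))\<^sup>2 + 4 * H t"])
    show "AE t in circle. (cmod (complex_of_real (W t)))\<^sup>2 \<le> 2 * (cmod (S 0 t))\<^sup>2 + 4 * H t"
      using hsum
    proof eventually_elim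
      case (elim t)
      have "H t \<ge> 0" unfolding H_def using elim hnn by (intro suminf_nonneg) auto
      then show ?case by (simp add: W_def)
    qed
  qed (use Hi L2_integrable_power2[OF S] in \<open>auto simp: W_def\<close>)
  have gW: "AE t in circle. cmod (g t) \<le> W t"
    using hsum
  proof eventually_elim
    case (elim t)
    show ?case
      by (rule LIMSEQ_le_const2[OF tendsto_norm[OF lim[OF elim]]]) (use bound[OF elim] in auto)
  qed
  have Wi: "integrable circle W" using integrable_Re[OF L2_integrable[OF W2]] by simp
  have "g \<in> L2"
  proof (rule L2_dominated[OF gm L2_integrable_power2[OF W2]])
    show "AE t in circle. (cmod (g t))\<^sup>2 \<le> (cmod (complex_of_real (W t)))\<^sup>2"
      using gW by eventually_elim (simp add: power_mono)
  qed
  moreover have "(\<lambda>k. fourier (S k) n) \<longlonglongrightarrow> fourier g n" for n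
  proof -
    have cm [measurable]: "(\<lambda>t. cis (- (of_int n * t))) \<in> borel_measurable circle"
      using L2_measurable[OF L2_cis[of "- of_int n"]] by simp
    show ?thesis
      unfolding fourier_def
    proof (intro tendsto_mult_left integral_dominated_convergence[where w = W])
      show "AE t in circle. (\<lambda>k. S k t * cis (- (of_int n * t))) \<longlonglongrightarrow> g t * cis (- (of_int n * t))"
        using hsum by eventually_elim (intro tendsto_intros lim)
      show "AE t in circle. norm (S k t * cis (- (of_int n * t))) \<le> W t" for k
        using hsum by eventually_elim (simp add: norm_mult bound)
    qed (use Wi in auto)
  qed
  ultimately show ?thesis by blast
qed

lemma riesz_fischer:
  assumes "(\<lambda>n. (cmod (c n))\<^sup>2) summable_on UNIV"
  obtains g where "g \<in> L2" "\<And>n. fourier g n = c n"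
proof -
  define q where "q = (\<lambda>n. (cmod (c n))\<^sup>2)"
  define A where "A = (\<lambda>N::nat. {- int N..int N})"
  define T where "T = infsum q UNIV"
  have qs: "(q has_sum T) UNIV" using assms unfolding T_def q_def by (rule has_sum_infsum)
  have fin: "finite (A N)" for N by (simp add: A_def)
  have ex: "\<exists>N. \<forall>F. finite F \<longrightarrow> F \<inter> A N = {} \<longrightarrow> sum q F \<le> (1/4) ^ k" for k
  proof -
    have "eventually (\<lambda>F. dist (sum q F) T < (1/4) ^ k) (finite_subsets_at_top UNIV)"
      using qs unfolding has_sum_def by (rule tendstoD) simp
    then obtain X where X: "finite X" "\<And>Y. finite Y \<Longrightarrow> X \<subseteq> Y \<Longrightarrow> dist (sum q Y) T < (1/4) ^ k"
      unfolding eventually_finite_subsets_at_top by auto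
    obtain N where N: "\<forall>n\<in>X. nat \<bar>n\<bar> \<le> N"
      using X(1) finite_nat_set_iff_bounded_le[of "(\<lambda>n. nat \<bar>n\<bar>) ` X"] by auto
    have XA: "X \<subseteq> A N" using N by (force simp: A_def)
    show ?thesis
    proof (intro exI allI impI)
      fix F assume F: "finite F" "F \<inter> A N = {}"
      have "sum q (F \<union> A N) \<le> T"
        using F fin by (intro finite_sum_le_has_sum[OF qs]) (auto simp: q_def)
      moreover have "sum q (F \<union> A N) = sum q F + sum q (A N)"
        using F fin by (intro sum.union_disjoint) auto
      moreover have "dist (sum q (A N)) T < (1/4) ^ k" using X(2)[OF fin XA] .
      ultimately show "sum q F \<le> (1/4) ^ k" by (auto simp: dist_real_def)
    qed
  qed
  \<comment> \<open>Tails beyond \<open>A (r k)\<close> are at most \<open>(1/4) ^ k\<close>, so the symmetric partial sums along \<open>r\<close> approach each other geometrically.\<close>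
  have "\<exists>r. \<forall>k. (\<forall>F. finite F \<longrightarrow> F \<inter> A (r k) = {} \<longrightarrow> sum q F \<le> (1/4) ^ k) \<and> r k < r (Suc k)"
  proof (rule dependent_nat_choice)
    show "\<exists>N. \<forall>F. finite F \<longrightarrow> F \<inter> A N = {} \<longrightarrow> sum q F \<le> (1/4) ^ 0" by (rule ex)
    fix N :: nat and k
    obtain M where M: "\<forall>F. finite F \<longrightarrow> F \<inter> A M = {} \<longrightarrow> sum q F \<le> (1/4) ^ Suc k" using ex by blast
    have "A M \<subseteq> A (max M (Suc N))" by (auto simp: A_def)
    with M show "\<exists>M. (\<forall>F. finite F \<longrightarrow> F \<inter> A M = {} \<longrightarrow> sum q F \<le> (1/4) ^ Suc k) \<and> N < M"
      by (intro exI[of _ "max M (Suc N)"] conjI allI impI) (blast, simp)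
  qed
  then obtain r where r: "\<And>k F. finite F \<Longrightarrow> F \<inter> A (r k) = {} \<Longrightarrow> sum q F \<le> (1/4) ^ k"
    and rS: "\<And>k. r k < r (Suc k)" by blast
  have mono: "strict_mono r" using rS by (simp add: strict_mono_Suc_iff)
  define S where "S = (\<lambda>k t. \<Sum>n\<in>A (r k). c n * cis (of_int n * t))"
  have "\<exists>g\<in>L2. \<forall>n. (\<lambda>k. fourier (S k) n) \<longlonglongrightarrow> fourier g n"
  proof (rule L2_limit_of_rapid_sequence[where C = "2 * pi"])
    fix k
    show "S k \<in> L2" unfolding S_def by (rule L2_trig)
    have sub: "A (r k) \<subseteq> A (r (Suc k))" using rS[of k] by (auto simp: A_def)
    have "S (Suc k) t - S k t = (\<Sum>n\<in>A (r (Suc k)) - A (r k). c n * cis (of_int n * t))" for t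
      unfolding S_def by (rule sum_diff[OF fin sub, symmetric])
    then have "(LINT t|circle. (cmod (S (Suc k) t - S k t))\<^sup>2) = 2 * pi * sum q (A (r (Suc k)) - A (r k))"
      unfolding q_def using fin by (simp only: norm_trig finite_Diff)
    also have "\<dots> \<le> 2 * pi * (1/4) ^ k"
      using fin by (intro mult_left_mono r) auto
    finally show "(LINT t|circle. (cmod (S (Suc k) t - S k t))\<^sup>2) \<le> 2 * pi * (1/4) ^ k" .
  qed
  then obtain g where g: "g \<in> L2" "\<And>n. (\<lambda>k. fourier (S k) n) \<longlonglongrightarrow> fourier g n" by blast
  have "fourier g n = c n" for n
  proof (rule LIMSEQ_unique[OF g(2)])
    have "fourier (S k) n = c n" if "k \<ge> nat \<bar>n\<bar>" for k
    proof -
      have "n \<in> A (r k)" using seq_suble[OF mono, of k] that by (auto simp: A_def)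
      then show ?thesis unfolding S_def by (simp add: fourier_trig[OF fin])
    qed
    then show "(\<lambda>k. fourier (S k) n) \<longlonglongrightarrow> c n"
      by (intro tendsto_eventually) (auto simp: eventually_sequentially)
  qed
  with g(1) show ?thesis by (rule that)
qed

section \<open>Translations and convolution with finitely supported measures\<close>

lemma rmod_2pi_in_circle: "x rmod (2 * pi) \<in> {0..<2 * pi}"
  using rmod_nonneg[of "2 * pi" x] rmod_less[of "2 * pi" x] by simp

lemma rmod_2pi_obtain: obtains n :: int where "x = x rmod (2 * pi) + of_int n * (2 * pi)"
  by (rule that[of "\<lfloor>x / \<bar>2 * pi\<bar>\<rfloor>"]) (simp add: rmod_def)

lemma cis_rmod: "cis (of_int n * (x rmod (2 * pi))) = cis (of_int n * x)"
proof -
  obtain m where m: "x = x rmod (2 * pi) + of_int m * (2 * pi)" by (rule rmod_2pi_obtain)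
  have "cis (of_int n * x) = cis (of_int n * (x rmod (2 * pi)) + 2 * pi * of_int (n * m))"
    by (subst m) (simp add: algebra_simps)
  also have "\<dots> = cis (of_int n * (x rmod (2 * pi)))"
    by (subst cis_mult[symmetric]) (simp only: cis_multiple_2pi Ints_of_int mult_1_right)
  finally show ?thesis ..
qed

lemma rmod_measurable [measurable]: "(\<lambda>t. t rmod (2 * pi)) \<in> borel_measurable borel"
  unfolding rmod_def by measurable

lemma measurable_rmod_circle:
  assumes "f \<in> borel_measurable M"
  shows "(\<lambda>t. f t rmod (2 * pi)) \<in> measurable M circle"
  unfolding circle_def
  by (rule measurable_restrict_space2)
     (use rmod_2pi_in_circle measurable_compose[OF assms rmod_measurable] in auto)

lemma emeasure_lborel_shift:
  "B \<in> sets borel \<Longrightarrow> emeasure lborel ((\<lambda>t. c + t) -` B) = emeasure lborel B" for c :: real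
  by (subst (2) lborel_distr_plus[of c, symmetric]) (simp add: emeasure_distr)

lemma distr_circle_translate: "distr circle circle (\<lambda>t. (t - x) rmod (2 * pi)) = circle"
proof -
  define y where "y = x rmod (2 * pi)"
  have y: "0 \<le> y" "y < 2 * pi" using rmod_2pi_in_circle[of x] by (auto simp: y_def)
  have xy: "(t - x) rmod (2 * pi) = (t - y) rmod (2 * pi)" for t
    by (metis rmod_diff rmod_rmod y_def)
  have low: "(t - y) rmod (2 * pi) = t - y" if "y \<le> t" "t < 2 * pi" for t
    using that y by (intro rmod_idem) auto
  have high: "(t - y) rmod (2 * pi) = 2 * pi - y + t" if "0 \<le> t" "t < y" for t
    using that y by (intro rmod_unique[of _ _ _ "-1"]) auto
  have m: "(\<lambda>t. (t - y) rmod (2 * pi)) \<in> measurable circle circle"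
    by (intro measurable_rmod_circle measurable_circle) measurable
  have "distr circle circle (\<lambda>t. (t - y) rmod (2 * pi)) = circle"
  proof (rule measure_eqI)
    fix A assume "A \<in> sets (distr circle circle (\<lambda>t. (t - y) rmod (2 * pi)))"
    then have A: "A \<in> sets circle" by simp
    then have Ab [measurable]: "A \<in> sets borel" and Asub: "A \<subseteq> {0..<2 * pi}" by (auto simp: sets_circle_iff)
    \<comment> \<open>The translation is cut where it wraps around: \<open>A\<close> below \<open>2 * pi - y\<close> is moved up by \<open>y\<close>, the rest down by \<open>2 * pi - y\<close>.\<close>
    let ?P = "(\<lambda>t. (t - y) rmod (2 * pi)) -` A \<inter> {0..<2 * pi}"
    let ?A1 = "A \<inter> {..<2 * pi - y}" and ?A2 = "A \<inter> {2 * pi - y..}"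
    have P: "?P = (\<lambda>t. - y + t) -` ?A1 \<union> (\<lambda>t. (2 * pi - y) + t) -` ?A2"
    proof (intro set_eqI iffI)
      fix t assume "t \<in> ?P"
      then show "t \<in> (\<lambda>t. - y + t) -` ?A1 \<union> (\<lambda>t. (2 * pi - y) + t) -` ?A2"
        by (cases "y \<le> t") (auto simp: low high)
    next
      fix t assume "t \<in> (\<lambda>t. - y + t) -` ?A1 \<union> (\<lambda>t. (2 * pi - y) + t) -` ?A2"
      then consider "- y + t \<in> A" "t < 2 * pi" | "2 * pi - y + t \<in> A" "0 \<le> t" by auto
      then show "t \<in> ?P"
      proof cases
        case 1
        then have "y \<le> t" using Asub by force
        then show ?thesis using 1 y by (simp add: low)
      next
        case 2
        then have "t < y" using Asub by force
        then show ?thesis using 2 y by (simp add: high)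
      qed
    qed
    have meas: "(\<lambda>t. c + t) -` B \<in> sets lborel" if "B \<in> sets borel" for c :: real and B
      using measurable_sets[of "\<lambda>t. c + t" borel borel B] that by simp
    have "emeasure (distr circle circle (\<lambda>t. (t - y) rmod (2 * pi))) A = emeasure circle ?P"
      using A m by (subst emeasure_distr) (auto simp: space_circle)
    also have "\<dots> = emeasure lborel ?P"
      using measurable_sets[OF m A] by (intro emeasure_circle) (simp add: space_circle)
    also have "\<dots> = emeasure lborel ((\<lambda>t. - y + t) -` ?A1) + emeasure lborel ((\<lambda>t. (2 * pi - y) + t) -` ?A2)"
      unfolding P
    proof (rule plus_emeasure[symmetric])
      show "(\<lambda>t. - y + t) -` ?A1 \<inter> (\<lambda>t. (2 * pi - y) + t) -` ?A2 = {}"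
      proof (rule equals0I)
        fix t assume "t \<in> (\<lambda>t. - y + t) -` ?A1 \<inter> (\<lambda>t. (2 * pi - y) + t) -` ?A2"
        then have "- y + t \<in> {0..<2 * pi}" "2 * pi - y + t \<in> {0..<2 * pi}" using Asub by auto
        then show False by simp
      qed
    qed (intro meas; measurable)+
    also have "\<dots> = emeasure lborel ?A1 + emeasure lborel ?A2"
    proof -
      have "?A1 \<in> sets borel" "?A2 \<in> sets borel" by measurable
      then show ?thesis by (simp only: emeasure_lborel_shift)
    qed
    also have "\<dots> = emeasure lborel (?A1 \<union> ?A2)"
      by (rule plus_emeasure) auto
    also have "?A1 \<union> ?A2 = A" by auto
    also have "emeasure lborel A = emeasure circle A" using A by (rule emeasure_circle[symmetric])
    finally show "emeasure (distr circle circle (\<lambda>t. (t - y) rmod (2 * pi))) A = emeasure circle A" .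
  qed simp
  then show ?thesis by (simp only: xy)
qed

lemma measurable_translate: "(\<lambda>t. (t - x) rmod (2 * pi)) \<in> measurable circle circle"
  by (intro measurable_rmod_circle measurable_circle) measurable

lemma integral_translate:
  fixes f :: "real \<Rightarrow> 'a::{banach,second_countable_topology}"
  assumes "f \<in> borel_measurable circle"
  shows "(LINT t|circle. f ((t - x) rmod (2 * pi))) = (LINT t|circle. f t)"
  using integral_distr[OF measurable_translate assms, of x] by (simp add: distr_circle_translate)

lemma integrable_translate:
  fixes f :: "real \<Rightarrow> 'a::{banach,second_countable_topology}"
  assumes "integrable circle f"
  shows "integrable circle (\<lambda>t. f ((t - x) rmod (2 * pi)))"
  using integrable_distr_eq[OF measurable_translate borel_measurable_integrable[OF assms], of x] assms
  by (simp add: distr_circle_translate)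

lemma L2_translate:
  assumes "f \<in> L2" shows "(\<lambda>t. f ((t - x) rmod (2 * pi))) \<in> L2"
  using integrable_translate[OF L2_integrable_power2[OF assms], of x]
    measurable_compose[OF measurable_translate L2_measurable[OF assms], of x]
  by (simp add: L2_def)

lemma fourier_translate:
  assumes "f \<in> L2"
  shows "fourier (\<lambda>t. f ((t - x) rmod (2 * pi))) n = cis (- (of_int n * x)) * fourier f n"
proof -
  let ?g = "\<lambda>t. f t * cis (- (of_int n * t)) * cis (- (of_int n * x))"
  have eq: "f ((t - x) rmod (2 * pi)) * cis (- (of_int n * t)) = ?g ((t - x) rmod (2 * pi))" for t
    using cis_rmod[of "- n" "t - x"] by (simp add: mult.assoc cis_mult algebra_simps)
  have "(LINT t|circle. f ((t - x) rmod (2 * pi)) * cis (- (of_int n * t)))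
      = (LINT t|circle. ?g ((t - x) rmod (2 * pi)))" by (simp only: eq)
  also have "\<dots> = (LINT t|circle. ?g t)"
    using borel_measurable_integrable[OF integrable_L2_cis[OF assms, of n]]
    by (intro integral_translate) auto
  also have "\<dots> = (LINT t|circle. f t * cis (- (of_int n * t))) * cis (- (of_int n * x))"
    by (rule integral_mult_left_zero)
  finally show ?thesis by (simp only: fourier_def mult_ac)
qed

subsection \<open>Integration against a finitely supported measure\<close>

text \<open>For a signed combination of point masses in \<open>Y\<close>, the supremum defining the positive variation on \<open>E\<close>
  is attained on the points of \<open>E\<close> with positive weight.\<close>

lemma pos_variation_discrete:
  fixes r :: "real \<Rightarrow> real"
  assumes Y: "finite Y" "Y \<subseteq> {0..<2 * pi}"
    and \<nu>: "\<forall>A\<in>sets circle. \<nu> A = (\<Sum>y\<in>Y. r y * indicator A y)"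
  shows "pos_variation \<nu> = distr (point_measure Y (\<lambda>y. ennreal (max 0 (r y)))) circle (\<lambda>y. y)"
    (is "_ = ?D")
proof -
  have m: "(\<lambda>y. y) \<in> measurable (point_measure Y (\<lambda>y. ennreal (max 0 (r y)))) circle"
    using Y by (auto simp: space_circle)
  have "?D = measure_of (space circle) (sets circle) (emeasure ?D)"
    using measure_of_of_measure[of ?D] by simp
  moreover have "(SUP A\<in>{A \<in> sets circle. A \<subseteq> E}. ennreal (\<nu> A)) = emeasure ?D E"
    if E: "E \<in> sets circle" for E
  proof -
    have "emeasure ?D E = emeasure (point_measure Y (\<lambda>y. ennreal (max 0 (r y)))) (E \<inter> Y)"
      using m E by (subst emeasure_distr) (auto simp: space_point_measure)
    also have "\<dots> = (\<Sum>y\<in>E \<inter> Y. ennreal (max 0 (r y)))"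
      using Y by (subst emeasure_point_measure_finite) auto
    finally have D: "emeasure ?D E = ennreal (\<Sum>y\<in>E \<inter> Y. max 0 (r y))"
      by (simp add: sum_ennreal)
    have \<nu>': "\<nu> A = (\<Sum>y\<in>A \<inter> Y. r y)" if "A \<in> sets circle" for A
      unfolding bspec[OF \<nu> that] using Y by (simp add: sum.inter_filter[symmetric] Int_def conj_commute indicator_def if_distrib cong: if_cong)
    show ?thesis
      unfolding D
    proof (rule antisym)
      show "(SUP A\<in>{A \<in> sets circle. A \<subseteq> E}. ennreal (\<nu> A)) \<le> ennreal (\<Sum>y\<in>E \<inter> Y. max 0 (r y))"
      proof (rule SUP_least)
        fix A assume A: "A \<in> {A \<in> sets circle. A \<subseteq> E}"
        then have "\<nu> A \<le> (\<Sum>y\<in>A \<inter> Y. max 0 (r y))"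
          by (simp add: \<nu>' sum_mono)
        also have "\<dots> \<le> (\<Sum>y\<in>E \<inter> Y. max 0 (r y))"
          using A Y by (intro sum_mono2) auto
        finally show "ennreal (\<nu> A) \<le> ennreal (\<Sum>y\<in>E \<inter> Y. max 0 (r y))"
          by (rule ennreal_leI)
      qed
    next
      let ?A = "{y \<in> E \<inter> Y. 0 < r y}"
      have A: "?A \<in> sets circle" using Y by (intro finite_sets_circle) auto
      have "(\<Sum>y\<in>E \<inter> Y. max 0 (r y)) = (\<Sum>y\<in>?A. r y)"
        using Y by (intro sum.mono_neutral_cong_right) auto
      also have "\<dots> = \<nu> ?A"
        unfolding \<nu>'[OF A] by (intro sum.cong) auto
      finally have "ennreal (\<Sum>y\<in>E \<inter> Y. max 0 (r y)) = ennreal (\<nu> ?A)" by simp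
      also have "\<dots> \<le> (SUP A\<in>{A \<in> sets circle. A \<subseteq> E}. ennreal (\<nu> A))"
        using A by (intro SUP_upper) auto
      finally show "ennreal (\<Sum>y\<in>E \<inter> Y. max 0 (r y)) \<le> (SUP A\<in>{A \<in> sets circle. A \<subseteq> E}. ennreal (\<nu> A))" .
    qed
  qed
  ultimately show ?thesis
    unfolding pos_variation_def
    by (metis (no_types, lifting) measure_of_eq sets.sigma_sets_eq sets.space_closed)
qed

lemma signed_integral_discrete:
  fixes r :: "real \<Rightarrow> real"
  assumes Y: "finite Y" "Y \<subseteq> {0..<2 * pi}"
    and \<nu>: "\<forall>A\<in>sets circle. \<nu> A = (\<Sum>y\<in>Y. r y * indicator A y)"
    and g: "g \<in> borel_measurable circle"
  shows "signed_integral \<nu> g = (\<Sum>y\<in>Y. complex_of_real (r y) * g y)"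
proof -
  have int: "(LINT x|pos_variation \<nu>. g x) = (\<Sum>y\<in>Y. complex_of_real (max 0 (r y)) * g y)"
    if \<nu>: "\<forall>A\<in>sets circle. \<nu> A = (\<Sum>y\<in>Y. r y * indicator A y)" for \<nu> r
  proof -
    have m: "(\<lambda>y. y) \<in> measurable (point_measure Y (\<lambda>y. ennreal (max 0 (r y)))) circle"
      using Y by (auto simp: space_circle)
    have "(LINT x|pos_variation \<nu>. g x) = (LINT y|point_measure Y (\<lambda>y. ennreal (max 0 (r y))). g y)"
      unfolding pos_variation_discrete[OF Y \<nu>] by (rule integral_distr[OF m g])
    also have "\<dots> = (\<Sum>y\<in>Y. max 0 (r y) *\<^sub>R g y)"
      using Y by (intro lebesgue_integral_point_measure_finite) auto
    finally show ?thesis by (simp add: scaleR_conv_of_real)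
  qed
  have \<nu>': "\<forall>A\<in>sets circle. (- \<nu>) A = (\<Sum>y\<in>Y. (- r y) * indicator A y)"
    using \<nu> by (simp add: sum_negf)
  have "signed_integral \<nu> g = (\<Sum>y\<in>Y. complex_of_real (max 0 (r y)) * g y - complex_of_real (max 0 (- r y)) * g y)"
    unfolding signed_integral_def int[OF \<nu>] int[OF \<nu>'] by (simp add: sum_subtractf)
  also have "\<dots> = (\<Sum>y\<in>Y. complex_of_real (r y) * g y)"
    by (intro sum.cong refl) (auto simp: max_def)
  finally show ?thesis .
qed

lemma cm_integral_discrete:
  fixes c :: "real \<Rightarrow> complex"
  assumes Y: "finite Y" "Y \<subseteq> {0..<2 * pi}"
    and \<mu>: "\<forall>A\<in>sets circle. \<mu> A = (\<Sum>y\<in>Y. c y * indicator A y)"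
    and g: "g \<in> borel_measurable circle"
  shows "cm_integral \<mu> g = (\<Sum>y\<in>Y. c y * g y)"
proof -
  have re: "\<forall>A\<in>sets circle. Re (\<mu> A) = (\<Sum>y\<in>Y. Re (c y) * indicator A y)"
    and im: "\<forall>A\<in>sets circle. Im (\<mu> A) = (\<Sum>y\<in>Y. Im (c y) * indicator A y)"
    using \<mu> by (auto simp: indicator_def intro!: sum.cong)
  have "cm_integral \<mu> g = (\<Sum>y\<in>Y. complex_of_real (Re (c y)) * g y + \<i> * (complex_of_real (Im (c y)) * g y))"
    unfolding cm_integral_def signed_integral_discrete[OF Y re g] signed_integral_discrete[OF Y im g]
    by (simp add: sum.distrib sum_distrib_left)
  also have "\<dots> = (\<Sum>y\<in>Y. c y * g y)"
    by (intro sum.cong refl) (subst (3) complex_eq, simp add: algebra_simps)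
  finally show ?thesis .
qed

text \<open>The finitely supported complex measure with the point masses listed in \<open>L\<close>: a pair \<open>(c, x)\<close> stands
  for \<open>c\<close> times the Dirac measure at \<open>x\<close> (read modulo \<open>2 * pi\<close>), and points may be repeated.\<close>

definition atoms :: "(complex \<times> real) list \<Rightarrow> real set \<Rightarrow> complex" where
  "atoms L E = (\<Sum>(c, x)\<leftarrow>L. c * dirac x E)"

text \<open>The Fourier transform of \<open>atoms L\<close>, normalised so that the unit point mass at \<open>0\<close> has transform \<open>1\<close>.\<close>

definition atoms_hat :: "(complex \<times> real) list \<Rightarrow> int \<Rightarrow> complex" where
  "atoms_hat L n = (\<Sum>(c, x)\<leftarrow>L. c * cis (- (of_int n * x)))"

text \<open>The list of point masses of the convolution of \<open>atoms L\<close> and \<open>atoms L'\<close>.\<close>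

definition atoms_conv :: "(complex \<times> real) list \<Rightarrow> (complex \<times> real) list \<Rightarrow> (complex \<times> real) list" where
  "atoms_conv L L' = concat (map (\<lambda>(c, x). map (\<lambda>(d, y). (c * d, x + y)) L') L)"

lemma sum_list_atoms_conv:
  "(\<Sum>p\<leftarrow>atoms_conv L L'. F p) = (\<Sum>(c, x)\<leftarrow>L. \<Sum>(d, y)\<leftarrow>L'. F (c * d, x + y))"
  by (induction L) (auto simp: atoms_conv_def o_def case_prod_unfold)

lemma cm_integral_atoms:
  assumes g: "g \<in> borel_measurable circle"
  shows "cm_integral (atoms L) g = (\<Sum>(c, x)\<leftarrow>L. c * g (x rmod (2 * pi)))"
proof -
  define Y where "Y = (\<lambda>(c, x). x rmod (2 * pi)) ` set L"
  define C where "C = (\<lambda>L y. \<Sum>(c, x)\<leftarrow>L. if x rmod (2 * pi) = y then c else (0::complex))"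
  have Y: "finite Y" "Y \<subseteq> {0..<2 * pi}"
    using rmod_2pi_in_circle by (auto simp: Y_def)
  \<comment> \<open>Collecting the masses that sit at the same point of the circle.\<close>
  have collect: "(\<Sum>(c, x)\<leftarrow>M. c * h (x rmod (2 * pi))) = (\<Sum>y\<in>Y. C M y * h y)"
    if "set M \<subseteq> set L" for M and h :: "real \<Rightarrow> complex"
    using that
  proof (induction M)
    case (Cons p M)
    obtain c x where p: "p = (c, x)" by (cases p)
    have "x rmod (2 * pi) \<in> Y" using Cons.prems p by (force simp: Y_def)
    then have "(\<Sum>y\<in>Y. (if x rmod (2 * pi) = y then c else 0) * h y) = c * h (x rmod (2 * pi))"
      using Y by (simp add: if_distrib[of "\<lambda>u. u * _"] cong: if_cong)
    then show ?case using Cons by (simp add: p C_def distrib_right sum.distrib)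
  qed (simp add: C_def)
  have \<mu>: "\<forall>A\<in>sets circle. atoms L A = (\<Sum>y\<in>Y. C L y * indicator A y)"
    using collect[of L "indicator _"]
    by (simp add: atoms_def dirac_def indicator_def of_bool_def case_prod_unfold)
  show ?thesis
    unfolding cm_integral_discrete[OF Y \<mu> g] using collect[of L g] by simp
qed

lemma borel_measurable_sum_list:
  fixes f :: "'i \<Rightarrow> 'a \<Rightarrow> complex"
  assumes "\<And>i. i \<in> set L \<Longrightarrow> f i \<in> borel_measurable M"
  shows "(\<lambda>x. \<Sum>i\<leftarrow>L. f i x) \<in> borel_measurable M"
  using assms by (induction L) auto

lemma conv_measure_atoms: "conv_measure (atoms L) (atoms L') = atoms (atoms_conv L L')"
proof
  fix E
  show "conv_measure (atoms L) (atoms L') E = atoms (atoms_conv L L') E"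
  proof (cases "E \<in> sets circle")
    case False
    then show ?thesis
      by (simp add: conv_measure_def atoms_def dirac_def case_prod_unfold)
  next
    case E: True
    have "{y \<in> space circle. (x + y) rmod (2 * pi) \<in> E} \<in> sets circle" for x
    proof -
      have "(\<lambda>y. (x + y) rmod (2 * pi)) \<in> measurable circle circle"
        by (intro measurable_rmod_circle measurable_circle) measurable
      from measurable_sets[OF this E] show ?thesis by (simp add: vimage_def Int_def conj_commute)
    qed
    then have inner: "atoms L' {y \<in> space circle. (x + y) rmod (2 * pi) \<in> E}
        = (\<Sum>(d, y)\<leftarrow>L'. d * indicator E ((x + y rmod (2 * pi)) rmod (2 * pi)))" for x
      using rmod_2pi_in_circle
      by (simp add: atoms_def dirac_def space_circle case_prod_unfold indicator_def of_bool_def)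
    have meas: "(\<lambda>x. \<Sum>(d, y)\<leftarrow>L'. d * indicator E ((x + y rmod (2 * pi)) rmod (2 * pi))) \<in> borel_measurable circle"
      unfolding case_prod_unfold
    proof (rule borel_measurable_sum_list)
      fix p :: "complex \<times> real"
      have [measurable]: "E \<in> sets circle" by (rule E)
      have [measurable]: "(\<lambda>x. (x + snd p rmod (2 * pi)) rmod (2 * pi)) \<in> measurable circle circle"
        by (intro measurable_rmod_circle measurable_circle) measurable
      show "(\<lambda>x. fst p * indicator E ((x + snd p rmod (2 * pi)) rmod (2 * pi))) \<in> borel_measurable circle"
        by measurable
    qed
    have "conv_measure (atoms L) (atoms L') E
        = (\<Sum>(c, x)\<leftarrow>L. c * (\<Sum>(d, y)\<leftarrow>L'. d * indicator E ((x rmod (2 * pi) + y rmod (2 * pi)) rmod (2 * pi))))"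
      unfolding conv_measure_def inner using E by (simp add: cm_integral_atoms[OF meas])
    also have "\<dots> = (\<Sum>(c, x)\<leftarrow>L. \<Sum>(d, y)\<leftarrow>L'. c * d * dirac (x + y) E)"
      by (simp only: case_prod_unfold rmod_add sum_list_const_mult[symmetric] mult.assoc)
         (simp add: E dirac_def indicator_def of_bool_def)
    also have "\<dots> = atoms (atoms_conv L L') E"
      unfolding atoms_def sum_list_atoms_conv by (simp add: case_prod_unfold)
    finally show ?thesis .
  qed
qed

lemma atoms_hat_conv: "atoms_hat (atoms_conv L L') n = atoms_hat L n * atoms_hat L' n"
proof -
  have cis: "c * d * cis (- (of_int n * (x + y))) = (c * cis (- (of_int n * x))) * (d * cis (- (of_int n * y)))"
    for c d :: complex and x y
  proof -
    have "cis (- (of_int n * (x + y))) = cis (- (of_int n * x)) * cis (- (of_int n * y))"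
      by (simp add: cis_mult algebra_simps)
    then show ?thesis by (simp only: mult_ac)
  qed
  have "atoms_hat (atoms_conv L L') n
      = (\<Sum>(c, x)\<leftarrow>L. \<Sum>(d, y)\<leftarrow>L'. c * d * cis (- (of_int n * (x + y))))"
    unfolding atoms_hat_def sum_list_atoms_conv by simp
  also have "\<dots> = (\<Sum>(c, x)\<leftarrow>L. \<Sum>(d, y)\<leftarrow>L'. (c * cis (- (of_int n * x))) * (d * cis (- (of_int n * y))))"
    by (simp only: cis)
  also have "\<dots> = atoms_hat L n * atoms_hat L' n"
    by (simp only: atoms_hat_def case_prod_unfold sum_list_const_mult sum_list_mult_const)
  finally show ?thesis .
qed

lemma conv_fun_atoms:
  assumes f: "f \<in> borel_measurable circle"
  shows "conv_fun (atoms L) f t = (\<Sum>(c, x)\<leftarrow>L. c * f ((t - x) rmod (2 * pi)))"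
proof -
  have "(\<lambda>y. (t - y) rmod (2 * pi)) \<in> measurable circle circle"
    by (intro measurable_rmod_circle measurable_circle) measurable
  then have m: "(\<lambda>y. f ((t - y) rmod (2 * pi))) \<in> borel_measurable circle"
    using f by (rule measurable_compose)
  have "(t - x rmod (2 * pi)) rmod (2 * pi) = (t - x) rmod (2 * pi)" for x
    by (metis rmod_diff rmod_rmod)
  then show ?thesis unfolding conv_fun_def cm_integral_atoms[OF m] by simp
qed

lemma conv_fun_atoms_L2:
  assumes f: "f \<in> L2"
  shows "conv_fun (atoms L) f \<in> L2 \<and> fourier (conv_fun (atoms L) f) n = atoms_hat L n * fourier f n"
proof (induction L)
  case Nil
  have "conv_fun (atoms []) f = (\<lambda>t. 0)"
    by (rule ext) (simp add: conv_fun_atoms[OF L2_measurable[OF f]])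
  then show ?case by (simp add: L2_zero fourier_zero atoms_hat_def)
next
  case (Cons p L)
  obtain c x where p: "p = (c, x)" by (cases p)
  have eq: "conv_fun (atoms (p # L)) f = (\<lambda>t. c * f ((t - x) rmod (2 * pi)) + conv_fun (atoms L) f t)"
    by (rule ext) (simp add: conv_fun_atoms[OF L2_measurable[OF f]] p)
  show ?case
    unfolding eq using Cons f
    by (simp add: L2_add L2_cmult L2_translate fourier_add fourier_cmult fourier_translate
        atoms_hat_def p distrib_right)
qed

subsection \<open>The multiplier of the difference operator\<close>

text \<open>The Fourier transform at \<open>n\<close> of \<open>diff_measure \<alpha> \<beta> b\<close>.  It is real, and for \<open>n = \<alpha>\<close> or \<open>n = \<beta>\<close> it
  vanishes for every \<open>b\<close>.\<close>

definition symbol :: "int \<Rightarrow> int \<Rightarrow> real \<Rightarrow> int \<Rightarrow> real" where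
  "symbol \<alpha> \<beta> b n = 4 * sin (b * of_int (n - \<alpha>) / 2) * sin (b * of_int (n - \<beta>) / 2)"

lemma diff_measure_atoms:
  "\<exists>L. diff_measure \<alpha> \<beta> b = atoms L \<and> (\<forall>n. atoms_hat L n = complex_of_real (symbol \<alpha> \<beta> b n))"
proof -
  define u where "u = b * (of_int (\<alpha> - \<beta>) / 2)"
  define v where "v = b * (of_int (\<alpha> + \<beta>) / 2)"
  let ?L = "[(cis u + cis (- u), 0), (- cis v, b), (- cis (- v), - b)]"
  have "diff_measure \<alpha> \<beta> b = atoms ?L"
    by (rule ext) (simp add: diff_measure_def atoms_def u_def v_def)
  moreover have "atoms_hat ?L n = complex_of_real (symbol \<alpha> \<beta> b n)" for n
  proof -
    define w where "w = of_int n * b - v"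
    have "cis v * cis (- (of_int n * b)) = cis (- w)" "cis (- v) * cis (of_int n * b) = cis w"
      by (simp_all add: cis_mult w_def)
    then have "atoms_hat ?L n = (cis u + cis (- u)) - (cis (- w) + cis w)"
      by (simp add: atoms_hat_def)
    also have "\<dots> = complex_of_real (2 * (cos u - cos w))"
      by (simp add: complex_eq_iff)
    also have "2 * (cos u - cos w) = symbol \<alpha> \<beta> b n"
    proof -
      have 1: "(u + w) / 2 = b * of_int (n - \<beta>) / 2" and 2: "(w - u) / 2 = b * of_int (n - \<alpha>) / 2"
        by (simp_all add: u_def v_def w_def field_simps)
      show ?thesis unfolding cos_diff_cos symbol_def 1 2 by simp
    qed
    finally show ?thesis .
  qed
  ultimately show ?thesis by blast
qed

lemma conv_power_atoms:
  "\<exists>L. conv_power (diff_measure \<alpha> \<beta> b) s = atoms L \<and>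
       (\<forall>n. atoms_hat L n = complex_of_real (symbol \<alpha> \<beta> b n) ^ s)"
proof (induction s)
  case 0
  have "dirac 0 = atoms [(1, 0)]" by (rule ext) (simp add: atoms_def)
  then show ?case by (intro exI[of _ "[(1, 0)]"]) (simp add: atoms_hat_def)
next
  case (Suc s)
  obtain L where L: "diff_measure \<alpha> \<beta> b = atoms L" "\<And>n. atoms_hat L n = complex_of_real (symbol \<alpha> \<beta> b n)"
    using diff_measure_atoms[of \<alpha> \<beta> b] by blast
  from Suc obtain M where M: "conv_power (diff_measure \<alpha> \<beta> b) s = atoms M"
    "\<And>n. atoms_hat M n = complex_of_real (symbol \<alpha> \<beta> b n) ^ s" by blast
  have "conv_power (diff_measure \<alpha> \<beta> b) (Suc s) = atoms (atoms_conv L M)"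
    by (simp only: conv_power.simps M(1) conv_measure_atoms[symmetric]) (simp only: L(1))
  then show ?case by (intro exI[of _ "atoms_conv L M"]) (simp add: atoms_hat_conv L(2) M(2))
qed

lemma conv_fun_diff_measure:
  assumes "f \<in> L2"
  shows "conv_fun (conv_power (diff_measure \<alpha> \<beta> b) s) f \<in> L2"
    and "fourier (conv_fun (conv_power (diff_measure \<alpha> \<beta> b) s) f) n
       = complex_of_real (symbol \<alpha> \<beta> b n) ^ s * fourier f n"
proof -
  obtain M where M: "conv_power (diff_measure \<alpha> \<beta> b) s = atoms M"
    "\<And>n. atoms_hat M n = complex_of_real (symbol \<alpha> \<beta> b n) ^ s"
    using conv_power_atoms by blast
  show "conv_fun (conv_power (diff_measure \<alpha> \<beta> b) s) f \<in> L2"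
    and "fourier (conv_fun (conv_power (diff_measure \<alpha> \<beta> b) s) f) n
       = complex_of_real (symbol \<alpha> \<beta> b n) ^ s * fourier f n"
    using conv_fun_atoms_L2[OF assms, of M n] by (simp_all add: M)
qed

section \<open>Sobolev spaces and the differential operator\<close>

lemma sobolev_L2: "f \<in> sobolev k \<Longrightarrow> f \<in> L2"
  by (simp add: sobolev_def)

lemma sobolev_mono:
  assumes "f \<in> sobolev k" "j \<le> k" shows "f \<in> sobolev j"
proof -
  have f: "f \<in> L2" using assms by (rule_tac sobolev_L2)
  \<comment> \<open>The summand \<open>1\<close> is needed only at \<open>n = 0\<close> with \<open>j = 0\<close>, where \<open>0 ^ 0 = 1\<close>.\<close>
  have le: "\<bar>real_of_int n\<bar> ^ (2 * j) \<le> 1 + \<bar>real_of_int n\<bar> ^ (2 * k)" for n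
  proof (cases "n = 0")
    case False
    then have "1 \<le> \<bar>real_of_int n\<bar>" by linarith
    then have "\<bar>real_of_int n\<bar> ^ (2 * j) \<le> \<bar>real_of_int n\<bar> ^ (2 * k)"
      using assms by (intro power_increasing) auto
    then show ?thesis by linarith
  qed (simp add: power_0_left)
  have "(\<lambda>n. \<bar>real_of_int n\<bar> ^ (2 * j) * (cmod (fourier f n))\<^sup>2) summable_on UNIV"
  proof (rule summable_on_comparison_test)
    show "(\<lambda>n. (cmod (fourier f n))\<^sup>2 + \<bar>real_of_int n\<bar> ^ (2 * k) * (cmod (fourier f n))\<^sup>2) summable_on UNIV"
      using assms fourier_summable[OF f] by (intro summable_on_add) (auto simp: sobolev_def)
    show "\<bar>real_of_int n\<bar> ^ (2 * j) * (cmod (fourier f n))\<^sup>2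
        \<le> (cmod (fourier f n))\<^sup>2 + \<bar>real_of_int n\<bar> ^ (2 * k) * (cmod (fourier f n))\<^sup>2" for n
      using mult_right_mono[OF le[of n], of "(cmod (fourier f n))\<^sup>2"] by (simp add: distrib_right)
  qed auto
  then show ?thesis using f by (simp add: sobolev_def)
qed

lemma sobolev_cmult: "f \<in> sobolev k \<Longrightarrow> (\<lambda>t. c * f t) \<in> sobolev k"
  using summable_on_cmult_right[of "\<lambda>n. \<bar>real_of_int n\<bar> ^ (2 * k) * (cmod (fourier f n))\<^sup>2" UNIV "(cmod c)\<^sup>2"]
  by (simp add: sobolev_def L2_cmult fourier_cmult norm_mult power_mult_distrib mult_ac)

lemma sobolev_add:
  assumes "f \<in> sobolev k" "g \<in> sobolev k" shows "(\<lambda>t. f t + g t) \<in> sobolev k"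
proof -
  note L = assms[THEN sobolev_L2]
  let ?w = "\<lambda>n. \<bar>real_of_int n\<bar> ^ (2 * k)"
  have "(\<lambda>n. ?w n * (cmod (fourier f n + fourier g n))\<^sup>2) summable_on UNIV"
  proof (rule summable_on_comparison_test)
    show "(\<lambda>n. 2 * (?w n * (cmod (fourier f n))\<^sup>2) + 2 * (?w n * (cmod (fourier g n))\<^sup>2)) summable_on UNIV"
      using assms by (intro summable_on_add summable_on_cmult_right) (auto simp: sobolev_def)
    show "?w n * (cmod (fourier f n + fourier g n))\<^sup>2
       \<le> 2 * (?w n * (cmod (fourier f n))\<^sup>2) + 2 * (?w n * (cmod (fourier g n))\<^sup>2)" for n
      using mult_left_mono[OF cmod_add_power2_le[of "fourier f n" "fourier g n"], of "?w n"]
      by (simp add: algebra_simps)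
  qed auto
  then show ?thesis using L by (simp add: sobolev_def L2_add fourier_add)
qed

lemma diff_op_sobolev:
  assumes "f \<in> sobolev (Suc k)"
  shows "diff_op f \<in> sobolev k" and "fourier (diff_op f) n = \<i> * of_int n * fourier f n"
proof -
  have norm: "(cmod (\<i> * of_int n * fourier f n))\<^sup>2 = \<bar>real_of_int n\<bar> ^ 2 * (cmod (fourier f n))\<^sup>2" for n
    by (simp add: norm_mult power_mult_distrib)
  have "f \<in> sobolev 1" by (rule sobolev_mono[OF assms]) simp
  then have "(\<lambda>n. (cmod (\<i> * of_int n * fourier f n))\<^sup>2) summable_on UNIV"
    unfolding norm by (simp add: sobolev_def)
  then have "\<exists>g. g \<in> L2 \<and> (\<forall>n. fourier g n = \<i> * of_int n * fourier f n)"
    by (rule riesz_fischer) blast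
  then have d: "diff_op f \<in> L2 \<and> (\<forall>n. fourier (diff_op f) n = \<i> * of_int n * fourier f n)"
    unfolding diff_op_def by (rule someI_ex)
  then show "fourier (diff_op f) n = \<i> * of_int n * fourier f n" by blast
  have "(\<lambda>n. \<bar>real_of_int n\<bar> ^ (2 * k) * (cmod (\<i> * of_int n * fourier f n))\<^sup>2) summable_on UNIV"
  proof -
    have "\<bar>x\<bar> ^ (2 * k) * (\<bar>x\<bar>\<^sup>2 * c) = \<bar>x\<bar> ^ (2 * Suc k) * c" for x c :: real
      by (simp add: power2_eq_square)
    then show ?thesis unfolding norm using assms by (simp only: sobolev_def mem_Collect_eq)
  qed
  then show "diff_op f \<in> sobolev k" using d by (simp add: sobolev_def)
qed

lemma quad_op_sobolev:
  assumes "f \<in> sobolev (k + 2)"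
  shows "quad_op \<alpha> \<beta> f \<in> sobolev k"
    and "fourier (quad_op \<alpha> \<beta> f) n = - (of_int ((n - \<alpha>) * (n - \<beta>)) * fourier f n)"
proof -
  have f: "f \<in> sobolev k" "f \<in> sobolev (Suc (Suc k))" using assms sobolev_mono[OF assms] by simp_all
  have d: "diff_op f \<in> sobolev (Suc k)" by (rule diff_op_sobolev[OF f(2)])
  have d': "diff_op f \<in> sobolev k" by (rule sobolev_mono[OF d]) simp
  have dd: "diff_op (diff_op f) \<in> sobolev k" by (rule diff_op_sobolev[OF d])
  have eq: "quad_op \<alpha> \<beta> f = (\<lambda>t. diff_op (diff_op f) t
      + ((- \<i> * of_int (\<alpha> + \<beta>)) * diff_op f t + (- of_int (\<alpha> * \<beta>)) * f t))"
    by (rule ext) (simp add: quad_op_def)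
  note S = dd sobolev_cmult[OF d'] sobolev_cmult[OF f(1)]
  show "quad_op \<alpha> \<beta> f \<in> sobolev k" unfolding eq by (intro sobolev_add S)
  have "fourier (quad_op \<alpha> \<beta> f) n = fourier (diff_op (diff_op f)) n
      + ((- \<i> * of_int (\<alpha> + \<beta>)) * fourier (diff_op f) n + (- of_int (\<alpha> * \<beta>)) * fourier f n)"
    unfolding eq using S[THEN sobolev_L2]
    by (simp only: fourier_add L2_add fourier_cmult)
  also have "\<dots> = - (of_int ((n - \<alpha>) * (n - \<beta>)) * fourier f n)"
    unfolding diff_op_sobolev(2)[OF d] diff_op_sobolev(2)[OF f(2)]
    by (simp add: algebra_simps)
  finally show "fourier (quad_op \<alpha> \<beta> f) n = - (of_int ((n - \<alpha>) * (n - \<beta>)) * fourier f n)" .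
qed

lemma quad_op_power_sobolev:
  assumes "g \<in> sobolev (k + 2 * s)"
  shows "(quad_op \<alpha> \<beta> ^^ s) g \<in> sobolev k"
    and "fourier ((quad_op \<alpha> \<beta> ^^ s) g) n = (- of_int ((n - \<alpha>) * (n - \<beta>))) ^ s * fourier g n"
  using assms
proof (induction s arbitrary: k)
  case (Suc s)
  {
    case 1
    then show ?case using Suc(1)[of "k + 2"] quad_op_sobolev(1)[of _ k] by simp
  next
    case 2
    then show ?case using Suc(1,2)[of "k + 2"] quad_op_sobolev(2)[of _ k] by simp
  }
qed auto

text \<open>Dividing the coefficients by \<open>- (n - \<alpha>) (n - \<beta>)\<close> inverts the operator; at the zeros of this
  polynomial division by zero returns the value \<open>0\<close>, which is the coefficient required there.\<close>

lemma ex_quad_op_eq: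
  assumes f: "f \<in> L2" and 0: "fourier f \<alpha> = 0" "fourier f \<beta> = 0"
  shows "\<exists>g\<in>sobolev 2. AE t in circle. quad_op \<alpha> \<beta> g t = f t"
proof -
  define q where "q = (\<lambda>n. complex_of_int ((n - \<alpha>) * (n - \<beta>)))"
  define c where "c = (\<lambda>n. - fourier f n / q n)"
  have q0: "q n = 0 \<Longrightarrow> fourier f n = 0" for n using 0 by (auto simp: q_def)
  have lin: "1 + \<bar>real_of_int n\<bar> \<le> (2 + \<bar>real_of_int a\<bar>) * \<bar>real_of_int (n - a)\<bar>" if "n \<noteq> a" for n a
  proof -
    have 1: "1 \<le> \<bar>real_of_int (n - a)\<bar>" using that by linarith
    have "1 + \<bar>real_of_int n\<bar> \<le> 2 * \<bar>real_of_int (n - a)\<bar> + \<bar>real_of_int a\<bar> * 1"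
      using 1 abs_triangle_ineq[of "real_of_int (n - a)" "real_of_int a"] by simp
    also have "\<dots> \<le> 2 * \<bar>real_of_int (n - a)\<bar> + \<bar>real_of_int a\<bar> * \<bar>real_of_int (n - a)\<bar>"
      using 1 by (intro add_left_mono mult_left_mono) auto
    finally show ?thesis by (simp add: algebra_simps)
  qed
  define K where "K = (2 + \<bar>real_of_int \<alpha>\<bar>) * (2 + \<bar>real_of_int \<beta>\<bar>)"
  have bound: "(1 + \<bar>real_of_int n\<bar>)\<^sup>2 * cmod (c n) \<le> K * cmod (fourier f n)" for n
  proof (cases "q n = 0")
    case False
    then have n: "n \<noteq> \<alpha>" "n \<noteq> \<beta>" by (auto simp: q_def)
    have "(1 + \<bar>real_of_int n\<bar>)\<^sup>2 \<le> K * cmod (q n)"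
      using mult_mono[OF lin[OF n(1)] lin[OF n(2)]]
      by (simp add: power2_eq_square K_def q_def norm_mult mult_ac del: of_int_diff)
    then have "(1 + \<bar>real_of_int n\<bar>)\<^sup>2 * cmod (c n) \<le> K * cmod (q n) * cmod (c n)"
      by (rule mult_right_mono) simp
    also have "\<dots> = K * cmod (fourier f n)"
      using False by (simp add: c_def norm_divide)
    finally show ?thesis .
  qed (simp add: c_def K_def)
  have ge: "(1 + \<bar>real_of_int n\<bar>)\<^sup>2 \<ge> 1" "(1 + \<bar>real_of_int n\<bar>)\<^sup>2 \<ge> \<bar>real_of_int n\<bar>\<^sup>2" for n
    by (simp_all add: power2_sum)
  have sum: "(\<lambda>n. (K * cmod (fourier f n))\<^sup>2) summable_on UNIV"
    using summable_on_cmult_right[OF fourier_summable[OF f], of "K\<^sup>2"] by (simp add: power_mult_distrib)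
  have "(\<lambda>n. (cmod (c n))\<^sup>2) summable_on UNIV"
  proof (rule summable_on_comparison_test[OF sum])
    fix n
    have "cmod (c n) \<le> (1 + \<bar>real_of_int n\<bar>)\<^sup>2 * cmod (c n)"
      using mult_right_mono[OF ge(1), of "cmod (c n)"] by simp
    then show "(cmod (c n))\<^sup>2 \<le> (K * cmod (fourier f n))\<^sup>2"
      using bound[of n] by (intro power_mono) auto
  qed auto
  then obtain g where g: "g \<in> L2" "\<And>n. fourier g n = c n" by (rule riesz_fischer) blast
  have "(\<lambda>n. \<bar>real_of_int n\<bar> ^ (2 * 2) * (cmod (fourier g n))\<^sup>2) summable_on UNIV"
  proof (rule summable_on_comparison_test[OF sum])
    fix n
    have "\<bar>real_of_int n\<bar>\<^sup>2 * cmod (c n) \<le> (1 + \<bar>real_of_int n\<bar>)\<^sup>2 * cmod (c n)"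
      using mult_right_mono[OF ge(2), of "cmod (c n)"] by simp
    then have "(\<bar>real_of_int n\<bar>\<^sup>2 * cmod (c n))\<^sup>2 \<le> (K * cmod (fourier f n))\<^sup>2"
      using bound[of n] by (intro power_mono) auto
    then show "\<bar>real_of_int n\<bar> ^ (2 * 2) * (cmod (fourier g n))\<^sup>2 \<le> (K * cmod (fourier f n))\<^sup>2"
      by (simp only: power_mult_distrib power_mult[symmetric] g)
  qed auto
  then have gs: "g \<in> sobolev (0 + 2)" using g by (simp add: sobolev_def)
  have "AE t in circle. quad_op \<alpha> \<beta> g t = f t"
  proof (rule fourier_eq_imp_AE[OF _ f])
    show "quad_op \<alpha> \<beta> g \<in> L2" by (rule sobolev_L2[OF quad_op_sobolev(1)[OF gs]])
    show "fourier (quad_op \<alpha> \<beta> g) n = fourier f n" for n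
    proof -
      have "- (q n * c n) = fourier f n" by (cases "q n = 0") (auto simp: c_def q0)
      then show ?thesis unfolding quad_op_sobolev(2)[OF gs] g by (simp only: q_def)
    qed
  qed
  moreover have "g \<in> sobolev 2" using gs by (simp only: add_0)
  ultimately show ?thesis by blast
qed

section \<open>Integrability of negative powers of the multipliers\<close>

text \<open>The negative power \<open>\<bar>x\<bar> powr (- \<gamma>)\<close> with the value \<open>\<infinity>\<close> at \<open>x = 0\<close>.  (The function \<open>powr\<close> itself
  returns \<open>0\<close> there, which would falsify the estimates below at the zeros of the multipliers.)\<close>

definition inv_powr :: "real \<Rightarrow> real \<Rightarrow> ennreal" where
  "inv_powr \<gamma> x = (if x = 0 then \<infinity> else ennreal (\<bar>x\<bar> powr (- \<gamma>)))"

lemma inv_powr_measurable [measurable]: "inv_powr \<gamma> \<in> borel_measurable borel"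
  unfolding inv_powr_def by measurable

lemma inv_powr_neq_0: "inv_powr \<gamma> x \<noteq> 0"
  by (simp add: inv_powr_def)

lemma inv_powr_minus: "inv_powr \<gamma> (- x) = inv_powr \<gamma> x"
  by (simp add: inv_powr_def)

lemma inv_powr_antimono:
  assumes "0 \<le> \<gamma>" "\<bar>x\<bar> \<le> \<bar>y\<bar>" shows "inv_powr \<gamma> y \<le> inv_powr \<gamma> x"
  using assms by (auto simp: inv_powr_def intro!: ennreal_leI powr_mono2')

lemma inv_powr_mult_le: "inv_powr \<gamma> (x * y) \<le> inv_powr (2 * \<gamma>) x + inv_powr (2 * \<gamma>) y"
proof (cases "x = 0 \<or> y = 0")
  case False
  define a where "a = \<bar>x\<bar> powr (- \<gamma>)"
  define b where "b = \<bar>y\<bar> powr (- \<gamma>)"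
  have ab: "a * b \<le> a\<^sup>2 + b\<^sup>2"
  proof -
    have "2 * (a * b) \<le> a\<^sup>2 + b\<^sup>2" using sum_squares_bound[of a b] by simp
    moreover have "0 \<le> a * b" by (simp add: a_def b_def)
    ultimately show ?thesis by linarith
  qed
  have sq: "(\<bar>z\<bar> powr (- \<gamma>))\<^sup>2 = \<bar>z\<bar> powr (- (2 * \<gamma>))" for z :: real
    by (simp add: power2_eq_square powr_add[symmetric])
  have "\<bar>x * y\<bar> powr (- \<gamma>) = a * b" by (simp add: a_def b_def abs_mult powr_mult)
  also note ab
  finally have "ennreal (\<bar>x * y\<bar> powr (- \<gamma>)) \<le> ennreal (a\<^sup>2 + b\<^sup>2)" by (rule ennreal_leI)
  also have "\<dots> = ennreal (a\<^sup>2) + ennreal (b\<^sup>2)" by simp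
  finally show ?thesis using False by (simp add: inv_powr_def a_def b_def sq)
qed (auto simp: inv_powr_def)

text \<open>Each summand is at most the sum, so the sum is at least the product of the \<open>card I\<close>-th roots of the
  summands; this is the reciprocal form of that inequality.\<close>

lemma inv_powr_1_sum_le_prod:
  fixes u :: "'i \<Rightarrow> real"
  assumes I: "finite I" "I \<noteq> {}"
  shows "inv_powr 1 (\<Sum>j\<in>I. (u j) ^ (2 * s)) \<le> (\<Prod>j\<in>I. inv_powr (real (2 * s) / real (card I)) (u j))"
proof (cases "\<exists>j\<in>I. u j = 0")
  case True
  then obtain j where j: "j \<in> I" "u j = 0" by blast
  have "(\<Prod>i\<in>I - {j}. inv_powr (real (2 * s) / real (card I)) (u i)) \<noteq> 0"
    using I by (simp add: prod_zero_iff inv_powr_neq_0)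
  then have "(\<Prod>i\<in>I. inv_powr (real (2 * s) / real (card I)) (u i)) = \<infinity>"
    using j I by (subst prod.remove[of _ j]) (auto simp: inv_powr_def ennreal_top_mult)
  then show ?thesis by simp
next
  case False
  define m where "m = real (card I)"
  define T where "T = (\<Sum>j\<in>I. (u j) ^ (2 * s))"
  have m: "m > 0" using I by (simp add: m_def card_gt_0_iff)
  have nn: "(u j) ^ (2 * s) \<ge> 0" for j by (simp add: power_mult)
  have le: "(u j) ^ (2 * s) \<le> T" if "j \<in> I" for j
    unfolding T_def using nn by (intro member_le_sum that I) auto
  obtain j where j: "j \<in> I" using I by blast
  have "0 < (u j) ^ (2 * s)" using False j by (simp add: power_mult)
  then have T: "T > 0" using le[OF j] by linarith
  have each: "T powr (- 1 / m) \<le> \<bar>u j\<bar> powr (- (real (2 * s) / m))" if "j \<in> I" for j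
  proof -
    have "0 < \<bar>u j\<bar>" using False that by auto
    then have "\<bar>u j\<bar> powr (- (real (2 * s) / m)) = (\<bar>u j\<bar> powr real (2 * s)) powr (- 1 / m)"
      by (simp add: powr_powr)
    also have "\<bar>u j\<bar> powr real (2 * s) = (u j) ^ (2 * s)"
      using \<open>0 < \<bar>u j\<bar>\<close> by (simp only: powr_realpow) (simp add: power_mult)
    finally show ?thesis
      using m le[OF that] False that by (simp add: powr_mono2' power_mult)
  qed
  have "\<bar>T\<bar> powr (- 1) = (\<Prod>j\<in>I. T powr (- 1 / m))"
    using T m I by (simp add: powr_power m_def)
  also have "\<dots> \<le> (\<Prod>j\<in>I. \<bar>u j\<bar> powr (- (real (2 * s) / m)))"
    by (intro prod_mono conjI each) auto
  finally have "ennreal (\<bar>T\<bar> powr (- 1)) \<le> ennreal (\<Prod>j\<in>I. \<bar>u j\<bar> powr (- (real (2 * s) / m)))"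
    by (rule ennreal_leI)
  also have "\<dots> = (\<Prod>j\<in>I. inv_powr (real (2 * s) / m) (u j))"
    using False by (subst prod_ennreal[symmetric]) (auto simp: inv_powr_def intro!: prod.cong)
  finally show ?thesis using T by (simp add: inv_powr_def T_def m_def)
qed

text \<open>From the cubic Taylor bound \<open>sin x \<ge> x - x ^ 3 / 6\<close> and \<open>x\<^sup>2 \<le> 4\<close>.\<close>

lemma sin_ge_third:
  assumes "0 \<le> x" "x \<le> pi / 2" shows "x / 3 \<le> sin x"
proof -
  have "\<bar>sin x - (\<Sum>m<3. sin_coeff m * x ^ m)\<bar> \<le> inverse (fact 3) * \<bar>x\<bar> ^ 3"
    by (rule Maclaurin_sin_bound)
  moreover have "(\<Sum>m<3. sin_coeff m * x ^ m) = x"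
    by (simp add: eval_nat_numeral sin_coeff_def)
  moreover have "fact 3 = (6 :: real)" by (simp add: eval_nat_numeral)
  ultimately have "\<bar>sin x - x\<bar> \<le> x ^ 3 / 6" using assms by (simp add: field_simps)
  then have 1: "x - x ^ 3 / 6 \<le> sin x" by linarith
  have "x \<le> 2" using assms pi_less_4 by linarith
  then have "x\<^sup>2 \<le> 2\<^sup>2" using assms by (intro power_mono) auto
  then have "x * x\<^sup>2 \<le> x * 4" using assms by (intro mult_left_mono) auto
  then have "x ^ 3 \<le> 4 * x" by (simp add: power3_eq_cube power2_eq_square mult_ac)
  with 1 show ?thesis by linarith
qed

lemma nn_integral_inv_powr_sin_finite:
  assumes "0 \<le> \<delta>" "\<delta> < 1"
  shows "(\<integral>\<^sup>+b. inv_powr \<delta> (sin (b / 2)) * indicator {0..<2 * pi} b \<partial>lborel) < \<infinity>"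
proof -
  define F where "F = (\<lambda>b. inv_powr \<delta> (b / 6) * indicator {0..2 * pi} b)"
  have [measurable]: "F \<in> borel_measurable borel" unfolding F_def by measurable
  have pt: "inv_powr \<delta> (sin (b / 2)) * indicator {0..<2 * pi} b \<le> F b + F (2 * pi - b)" for b
  proof (cases "b \<in> {0..<2 * pi}")
    case True
    show ?thesis
    proof (cases "b \<le> pi")
      case le: True
      have "(b / 2) / 3 \<le> sin (b / 2)" using True le by (intro sin_ge_third) auto
      then have "inv_powr \<delta> (sin (b / 2)) \<le> inv_powr \<delta> (b / 6)"
        using True by (intro inv_powr_antimono assms) auto
      then show ?thesis using True by (simp add: F_def add_increasing2)
    next
      case False
      have "((2 * pi - b) / 2) / 3 \<le> sin ((2 * pi - b) / 2)" using True False by (intro sin_ge_third) auto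
      also have "sin ((2 * pi - b) / 2) = sin (b / 2)" by (simp add: diff_divide_distrib)
      finally have "inv_powr \<delta> (sin (b / 2)) \<le> inv_powr \<delta> ((2 * pi - b) / 6)"
        using True by (intro inv_powr_antimono assms) auto
      then show ?thesis using True by (simp add: F_def add_increasing)
    qed
  qed simp
  have fin: "(\<integral>\<^sup>+b. F b \<partial>lborel) < \<infinity>"
  proof -
    have "((\<lambda>b. 6 powr \<delta> * b powr (- \<delta>)) has_integral 6 powr \<delta> * ((2 * pi) powr (- \<delta> + 1) / (- \<delta> + 1))) {0..2 * pi}"
      using assms by (intro has_integral_mult_right has_integral_powr_from_0) auto
    then have "(\<integral>\<^sup>+b. indicator {0..2 * pi} b * (6 powr \<delta> * b powr (- \<delta>)) \<partial>lborel)
        = ennreal (6 powr \<delta> * ((2 * pi) powr (- \<delta> + 1) / (- \<delta> + 1)))"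
      by (intro nn_integral_has_integral_lebesgue) auto
    moreover have "(\<integral>\<^sup>+b. F b \<partial>lborel) = (\<integral>\<^sup>+b. indicator {0..2 * pi} b * (6 powr \<delta> * b powr (- \<delta>)) \<partial>lborel)"
    proof (rule nn_integral_cong_AE)
      show "AE b in lborel. F b = ennreal (indicator {0..2 * pi} b * (6 powr \<delta> * b powr (- \<delta>)))"
        using AE_lborel_singleton[of 0]
      proof eventually_elim
        case (elim b)
        then show ?case
          by (cases "b \<in> {0..2 * pi}") (auto simp: F_def inv_powr_def powr_divide powr_minus field_simps)
      qed
    qed
    ultimately show ?thesis by simp
  qed
  have refl: "(\<integral>\<^sup>+b. F (2 * pi - b) \<partial>lborel) = (\<integral>\<^sup>+b. F b \<partial>lborel)"
    using nn_integral_real_affine[of F "-1" "2 * pi"] by simp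
  have "(\<integral>\<^sup>+b. inv_powr \<delta> (sin (b / 2)) * indicator {0..<2 * pi} b \<partial>lborel)
      \<le> (\<integral>\<^sup>+b. F b + F (2 * pi - b) \<partial>lborel)"
    by (intro nn_integral_mono pt)
  also have "\<dots> = (\<integral>\<^sup>+b. F b \<partial>lborel) + (\<integral>\<^sup>+b. F (2 * pi - b) \<partial>lborel)"
    by (intro nn_integral_add) measurable
  also have "\<dots> < \<infinity>" using fin by (simp add: refl)
  finally show ?thesis .
qed

text \<open>Multiplication by a nonzero integer preserves Lebesgue measure on the circle; here this is used
  for \<open>\<bar>sin (b / 2)\<bar> powr (- \<delta>)\<close> only, which has period \<open>2 * pi\<close>.\<close>

lemma nn_integral_inv_powr_sin_scale:
  fixes p :: int
  assumes "p \<noteq> 0"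
  shows "(\<integral>\<^sup>+b. inv_powr \<delta> (sin (b * of_int p / 2)) * indicator {0..<2 * pi} b \<partial>lborel)
       = (\<integral>\<^sup>+b. inv_powr \<delta> (sin (b / 2)) * indicator {0..<2 * pi} b \<partial>lborel)"
proof -
  define h where "h = (\<lambda>b. inv_powr \<delta> (sin (b / 2)))"
  have [measurable]: "h \<in> borel_measurable borel" unfolding h_def by measurable
  define H where "H = (\<lambda>k::nat. \<integral>\<^sup>+b. h b * indicator {0..<2 * pi * k} b \<partial>lborel)"
  have even: "h (- b) = h b" for b
    using inv_powr_minus[of \<delta> "sin (b / 2)"] by (simp add: h_def)
  have per: "h (2 * pi * k + b) = h b" for b and k :: nat
  proof (induction k)
    case (Suc k)
    have "sin ((2 * pi * Suc k + b) / 2) = - sin ((2 * pi * k + b) / 2)"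
      using sin_periodic_pi[of "(2 * pi * k + b) / 2"] by (simp add: field_simps)
    then show ?case using Suc by (simp add: h_def inv_powr_minus)
  qed simp
  have ind: "indicator {0..<c} b = (indicator {0..<a} b + indicator {a..<c} b :: ennreal)"
    if "0 \<le> a" "a \<le> c" for a b c :: real
    using that by (auto simp: indicator_def)
  have step: "H (Suc k) = H k + H 1" for k
  proof -
    have "H (Suc k) = (\<integral>\<^sup>+b. h b * indicator {0..<2 * pi * k} b
        + h b * indicator {2 * pi * k..<2 * pi * Suc k} b \<partial>lborel)"
      unfolding H_def by (subst ind[of "2 * pi * k"]) (auto simp: distrib_left)
    also have "\<dots> = H k + (\<integral>\<^sup>+b. h b * indicator {2 * pi * k..<2 * pi * Suc k} b \<partial>lborel)"
      unfolding H_def by (intro nn_integral_add) measurable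
    also have "(\<integral>\<^sup>+b. h b * indicator {2 * pi * k..<2 * pi * Suc k} b \<partial>lborel)
        = (\<integral>\<^sup>+b. h (2 * pi * k + b) * indicator {2 * pi * k..<2 * pi * Suc k} (2 * pi * k + b) \<partial>lborel)"
      by (subst nn_integral_real_affine[of _ 1 "2 * pi * k"]) (auto simp del: of_nat_Suc)
    also have "\<dots> = H 1"
      unfolding H_def per by (intro nn_integral_cong) (auto simp: indicator_def algebra_simps)
    finally show ?thesis .
  qed
  have H: "H k = of_nat k * H 1" for k
  proof (induction k)
    case (Suc k)
    then show ?case using step[of k] by (simp add: distrib_right add.commute)
  qed (simp add: H_def)
  have nat: "(\<integral>\<^sup>+b. h (k * b) * indicator {0..<2 * pi} b \<partial>lborel) = H 1" if "k > 0" for k :: nat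
  proof -
    have "H k = ennreal \<bar>real k\<bar> * (\<integral>\<^sup>+b. h (0 + k * b) * indicator {0..<2 * pi * k} (0 + k * b) \<partial>lborel)"
      unfolding H_def using that by (intro nn_integral_real_affine) auto
    also have "\<dots> = of_nat k * (\<integral>\<^sup>+b. h (k * b) * indicator {0..<2 * pi} b \<partial>lborel)"
      using that
      by (intro arg_cong2[where f = "(*)"] nn_integral_cong)
         (auto simp: indicator_def zero_le_mult_iff ennreal_of_nat_eq_real_of_nat mult.commute)
    finally have "of_nat k * (\<integral>\<^sup>+b. h (k * b) * indicator {0..<2 * pi} b \<partial>lborel) = of_nat k * H 1"
      by (simp add: H[of k])
    then show ?thesis using that by (simp add: ennreal_mult_cancel_left ennreal_of_nat_neq_top)
  qed
  have "h (b * of_int p) = h (real (nat \<bar>p\<bar>) * b)" for b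
    using even[of "b * of_int p"] by (cases "p \<ge> 0") (auto simp: mult.commute)
  then have "(\<integral>\<^sup>+b. h (b * of_int p) * indicator {0..<2 * pi} b \<partial>lborel) = H 1"
    using nat[of "nat \<bar>p\<bar>"] assms by simp
  then show ?thesis by (simp add: h_def H_def)
qed

lemma nn_integral_inv_powr_symbol:
  assumes "0 \<le> \<gamma>" "n \<noteq> \<alpha>" "n \<noteq> \<beta>"
  shows "(\<integral>\<^sup>+b. inv_powr \<gamma> (symbol \<alpha> \<beta> b n) * indicator {0..2 * pi} b \<partial>lborel)
    \<le> 2 * (\<integral>\<^sup>+b. inv_powr (2 * \<gamma>) (sin (b / 2)) * indicator {0..<2 * pi} b \<partial>lborel)"
    (is "_ \<le> 2 * ?J")
proof -
  let ?x = "\<lambda>p b. sin (b * of_int p / 2)"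
  have "(\<integral>\<^sup>+b. inv_powr \<gamma> (symbol \<alpha> \<beta> b n) * indicator {0..2 * pi} b \<partial>lborel)
      = (\<integral>\<^sup>+b. inv_powr \<gamma> (symbol \<alpha> \<beta> b n) * indicator {0..<2 * pi} b \<partial>lborel)"
  proof (rule nn_integral_cong_AE)
    show "AE b in lborel. inv_powr \<gamma> (symbol \<alpha> \<beta> b n) * indicator {0..2 * pi} b
        = inv_powr \<gamma> (symbol \<alpha> \<beta> b n) * indicator {0..<2 * pi} b"
      using AE_lborel_singleton[of "2 * pi"] by eventually_elim (auto split: split_indicator)
  qed
  also have "\<dots> \<le> (\<integral>\<^sup>+b. inv_powr (2 * \<gamma>) (?x (n - \<alpha>) b) * indicator {0..<2 * pi} b
      + inv_powr (2 * \<gamma>) (?x (n - \<beta>) b) * indicator {0..<2 * pi} b \<partial>lborel)"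
  proof (rule nn_integral_mono)
    fix b
    have "\<bar>?x (n - \<alpha>) b * ?x (n - \<beta>) b\<bar> \<le> \<bar>symbol \<alpha> \<beta> b n\<bar>"
      unfolding symbol_def by (simp add: abs_mult)
    then have "inv_powr \<gamma> (symbol \<alpha> \<beta> b n) \<le> inv_powr \<gamma> (?x (n - \<alpha>) b * ?x (n - \<beta>) b)"
      by (rule inv_powr_antimono[OF assms(1)])
    also have "\<dots> \<le> inv_powr (2 * \<gamma>) (?x (n - \<alpha>) b) + inv_powr (2 * \<gamma>) (?x (n - \<beta>) b)"
      by (rule inv_powr_mult_le)
    finally show "inv_powr \<gamma> (symbol \<alpha> \<beta> b n) * indicator {0..<2 * pi} b
        \<le> inv_powr (2 * \<gamma>) (?x (n - \<alpha>) b) * indicator {0..<2 * pi} b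
          + inv_powr (2 * \<gamma>) (?x (n - \<beta>) b) * indicator {0..<2 * pi} b"
      by (simp add: indicator_def)
  qed
  also have "\<dots> = (\<integral>\<^sup>+b. inv_powr (2 * \<gamma>) (?x (n - \<alpha>) b) * indicator {0..<2 * pi} b \<partial>lborel)
      + (\<integral>\<^sup>+b. inv_powr (2 * \<gamma>) (?x (n - \<beta>) b) * indicator {0..<2 * pi} b \<partial>lborel)"
    by (intro nn_integral_add) measurable
  also have "\<dots> = ?J + ?J"
    using assms by (subst (1 2) nn_integral_inv_powr_sin_scale) auto
  finally show ?thesis by (simp only: mult_2)
qed

section \<open>Sums of generalised differences\<close>

lemma fourier_eq_0_of_is_diff_sum:
  assumes f: "f \<in> L2" and s: "s \<ge> 1" and sum: "is_diff_sum \<alpha> \<beta> s m b f"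
  shows "fourier f \<alpha> = 0 \<and> fourier f \<beta> = 0"
proof -
  from sum obtain F where F: "\<And>j. j \<in> {1..m} \<Longrightarrow> F j \<in> L2"
    and ae: "AE t in circle. f t = (\<Sum>j=1..m. conv_fun (conv_power (diff_measure \<alpha> \<beta> (b j)) s) (F j) t)"
    unfolding is_diff_sum_def by blast
  have L: "conv_fun (conv_power (diff_measure \<alpha> \<beta> (b j)) s) (F j) \<in> L2" if "j \<in> {1..m}" for j
    by (rule conv_fun_diff_measure(1)[OF F[OF that]])
  have "fourier f n = (\<Sum>j=1..m. complex_of_real (symbol \<alpha> \<beta> (b j) n) ^ s * fourier (F j) n)" for n
  proof -
    have "fourier f n = fourier (\<lambda>t. \<Sum>j=1..m. conv_fun (conv_power (diff_measure \<alpha> \<beta> (b j)) s) (F j) t) n"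
      using f L by (intro fourier_cong_AE L2_measurable L2_sum ae) auto
    also have "\<dots> = (\<Sum>j=1..m. fourier (conv_fun (conv_power (diff_measure \<alpha> \<beta> (b j)) s) (F j)) n)"
      by (rule fourier_sum[OF L])
    also have "\<dots> = (\<Sum>j=1..m. complex_of_real (symbol \<alpha> \<beta> (b j) n) ^ s * fourier (F j) n)"
      by (intro sum.cong refl conv_fun_diff_measure(2) F)
    finally show ?thesis .
  qed
  then show ?thesis using s by (simp add: symbol_def power_0_left)
qed

text \<open>The candidates for the summands have the coefficients \<open>fourier f n * symbol ^ s / T n\<close>: multiplied by
  \<open>symbol ^ s\<close> and added up they give \<open>fourier f n\<close>, and their squares are at most
  \<open>\<bar>fourier f n\<bar>\<^sup>2 / T n\<close>.\<close>

lemma is_diff_sum_of_summable: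
  fixes \<alpha> \<beta> :: int and b :: "nat \<Rightarrow> real" and s m :: nat
  defines "T \<equiv> \<lambda>n. \<Sum>j=1..m. (symbol \<alpha> \<beta> (b j) n) ^ (2 * s)"
  assumes f: "f \<in> L2"
    and sum: "(\<lambda>n. (cmod (fourier f n))\<^sup>2 / T n) summable_on UNIV"
    and zero: "\<And>n. T n = 0 \<Longrightarrow> fourier f n = 0"
  shows "is_diff_sum \<alpha> \<beta> s m b f"
proof -
  define c where "c = (\<lambda>j n. fourier f n * complex_of_real ((symbol \<alpha> \<beta> (b j) n) ^ s / T n))"
  have nn: "(symbol \<alpha> \<beta> (b j) n) ^ (2 * s) \<ge> 0" for j n by (simp add: power_mult)
  have "\<exists>F. F \<in> L2 \<and> (\<forall>n. fourier F n = c j n)" if j: "j \<in> {1..m}" for j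
  proof -
    have "(\<lambda>n. (cmod (c j n))\<^sup>2) summable_on UNIV"
    proof (rule summable_on_comparison_test[OF sum])
      fix n
      let ?a = "symbol \<alpha> \<beta> (b j) n"
      have le: "?a ^ (2 * s) \<le> T n"
        unfolding T_def using nn j by (intro member_le_sum) auto
      have "(cmod (c j n))\<^sup>2 = (cmod (fourier f n))\<^sup>2 * (?a ^ (2 * s) / (T n)\<^sup>2)"
        by (simp add: c_def norm_mult norm_divide power_mult_distrib power_divide norm_power
          flip: power_mult) (simp add: mult.commute power_even_abs)
      also have "\<dots> \<le> (cmod (fourier f n))\<^sup>2 * (T n / (T n)\<^sup>2)"
        using le by (intro mult_left_mono divide_right_mono) auto
      also have "\<dots> = (cmod (fourier f n))\<^sup>2 / T n" by (simp add: power2_eq_square)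
      finally show "(cmod (c j n))\<^sup>2 \<le> (cmod (fourier f n))\<^sup>2 / T n" .
    qed auto
    then show ?thesis by (rule riesz_fischer) blast
  qed
  then obtain F where F: "\<And>j. j \<in> {1..m} \<Longrightarrow> F j \<in> L2 \<and> (\<forall>n. fourier (F j) n = c j n)"
    by metis
  have L: "conv_fun (conv_power (diff_measure \<alpha> \<beta> (b j)) s) (F j) \<in> L2" if "j \<in> {1..m}" for j
    using F[OF that] by (intro conv_fun_diff_measure(1)) auto
  have "AE t in circle. f t = (\<Sum>j=1..m. conv_fun (conv_power (diff_measure \<alpha> \<beta> (b j)) s) (F j) t)"
  proof (rule fourier_eq_imp_AE[OF f L2_sum[OF L]])
    fix n
    have "fourier (\<lambda>t. \<Sum>j=1..m. conv_fun (conv_power (diff_measure \<alpha> \<beta> (b j)) s) (F j) t) n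
        = (\<Sum>j=1..m. fourier (conv_fun (conv_power (diff_measure \<alpha> \<beta> (b j)) s) (F j)) n)"
      by (rule fourier_sum[OF L])
    also have "\<dots> = (\<Sum>j=1..m. complex_of_real (symbol \<alpha> \<beta> (b j) n) ^ s * c j n)"
    proof (rule sum.cong[OF refl])
      fix j assume "j \<in> {1..m}"
      from F[OF this] show "fourier (conv_fun (conv_power (diff_measure \<alpha> \<beta> (b j)) s) (F j)) n
          = complex_of_real (symbol \<alpha> \<beta> (b j) n) ^ s * c j n"
        by (simp add: conv_fun_diff_measure(2))
    qed
    also have "\<dots> = (\<Sum>j=1..m. fourier f n * complex_of_real ((symbol \<alpha> \<beta> (b j) n) ^ (2 * s) / T n))"
      by (intro sum.cong refl) (simp add: c_def mult_2 power_add)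
    also have "\<dots> = fourier f n * complex_of_real (T n / T n)"
      by (simp only: T_def sum_distrib_left sum_divide_distrib of_real_sum)
    also have "\<dots> = fourier f n" using zero[of n] by (cases "T n = 0") auto
    finally show "fourier f n = fourier (\<lambda>t. \<Sum>j=1..m. conv_fun (conv_power (diff_measure \<alpha> \<beta> (b j)) s) (F j) t) n" ..
  qed auto
  then show ?thesis using F unfolding is_diff_sum_def by blast
qed

interpretation lborel_product: product_sigma_finite "\<lambda>_::nat. lborel :: real measure"
  by standard

lemma symbol_component_measurable:
  "j \<in> I \<Longrightarrow> (\<lambda>b. symbol \<alpha> \<beta> (b j) n) \<in> borel_measurable (Pi\<^sub>M I (\<lambda>_. lborel))"
  unfolding symbol_def by measurable

lemma ennreal_power_mono: "x \<le> y \<Longrightarrow> x ^ n \<le> y ^ n" for x y :: ennreal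
  by (induction n) (auto intro: mult_mono)

text \<open>The decisive estimate: over the cube, the reciprocal of \<open>\<Sum>j. symbol ^ (2 * s)\<close> has an integral that
  is bounded independently of \<open>n \<noteq> \<alpha>, \<beta>\<close>.  With \<open>4 * s + 1\<close> variables the exponent \<open>4 * s / (4 * s + 1)\<close> of the
  sine is smaller than \<open>1\<close>, so the bound is finite by \<open>nn_integral_inv_powr_sin_finite\<close>.\<close>

lemma nn_integral_inverse_symbol_sum:
  fixes s :: nat
  assumes "n \<noteq> \<alpha>" "n \<noteq> \<beta>"
  shows "(\<integral>\<^sup>+b. inv_powr 1 (\<Sum>j=1..4 * s + 1. (symbol \<alpha> \<beta> (b j) n) ^ (2 * s))
            * (\<Prod>j=1..4 * s + 1. indicator {0..2 * pi} (b j)) \<partial>Pi\<^sub>M {1..4 * s + 1} (\<lambda>_. lborel))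
    \<le> (2 * (\<integral>\<^sup>+b. inv_powr (real (4 * s) / real (4 * s + 1)) (sin (b / 2)) * indicator {0..<2 * pi} b \<partial>lborel)) ^ (4 * s + 1)"
proof -
  define I where "I = {1..4 * s + 1}"
  define \<gamma> where "\<gamma> = real (2 * s) / real (card I)"
  have I: "finite I" "I \<noteq> {}" "card I = 4 * s + 1" by (auto simp: I_def)
  have \<gamma>: "0 \<le> \<gamma>" "2 * \<gamma> = real (4 * s) / real (4 * s + 1)"
    by (simp_all add: \<gamma>_def I(3))
  have "(\<integral>\<^sup>+b. inv_powr 1 (\<Sum>j\<in>I. (symbol \<alpha> \<beta> (b j) n) ^ (2 * s))
            * (\<Prod>j\<in>I. indicator {0..2 * pi} (b j)) \<partial>Pi\<^sub>M I (\<lambda>_. lborel))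
     \<le> (\<integral>\<^sup>+b. (\<Prod>j\<in>I. inv_powr \<gamma> (symbol \<alpha> \<beta> (b j) n) * indicator {0..2 * pi} (b j)) \<partial>Pi\<^sub>M I (\<lambda>_. lborel))"
    unfolding prod.distrib \<gamma>_def
    by (intro nn_integral_mono mult_right_mono inv_powr_1_sum_le_prod I) auto
  also have "\<dots> = (\<Prod>j\<in>I. \<integral>\<^sup>+b. inv_powr \<gamma> (symbol \<alpha> \<beta> b n) * indicator {0..2 * pi} b \<partial>lborel)"
  proof (rule lborel_product.product_nn_integral_prod[OF I(1)])
    show "(\<lambda>b. inv_powr \<gamma> (symbol \<alpha> \<beta> b n) * indicator {0..2 * pi} b) \<in> borel_measurable lborel"
      unfolding symbol_def by measurable
  qed
  also have "\<dots> = (\<integral>\<^sup>+b. inv_powr \<gamma> (symbol \<alpha> \<beta> b n) * indicator {0..2 * pi} b \<partial>lborel) ^ (4 * s + 1)"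
    by (simp only: prod_constant I(3))
  also have "\<dots> \<le> (2 * (\<integral>\<^sup>+b. inv_powr (2 * \<gamma>) (sin (b / 2)) * indicator {0..<2 * pi} b \<partial>lborel)) ^ (4 * s + 1)"
    by (intro ennreal_power_mono nn_integral_inv_powr_symbol assms \<gamma>)
  finally show ?thesis unfolding \<gamma>(2) by (simp only: I_def)
qed

lemma AE_is_diff_sum:
  fixes s :: nat
  assumes f: "f \<in> L2" and 0: "fourier f \<alpha> = 0" "fourier f \<beta> = 0"
  shows "AE b in Pi\<^sub>M {1..4 * s + 1} (\<lambda>_. lborel).
    (\<forall>j\<in>{1..4 * s + 1}. b j \<in> {0..2 * pi}) \<longrightarrow> is_diff_sum \<alpha> \<beta> s (4 * s + 1) b f"
proof -
  define P where "P = Pi\<^sub>M {1..4 * s + 1} (\<lambda>_. lborel :: real measure)"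
  define T where "T = (\<lambda>b n. \<Sum>j=1..4 * s + 1. (symbol \<alpha> \<beta> (b j) n) ^ (2 * s))"
  define B where "B = (\<lambda>b. \<Prod>j=1..4 * s + 1. indicator {0..2 * pi} (b j) :: ennreal)"
  define J where "J = (\<integral>\<^sup>+b. inv_powr (real (4 * s) / real (4 * s + 1)) (sin (b / 2)) * indicator {0..<2 * pi} b \<partial>lborel)"
  define q where "q = (\<lambda>n. (cmod (fourier f n))\<^sup>2)"
  \<comment> \<open>At \<open>n = \<alpha>\<close> and \<open>n = \<beta>\<close> the factor \<open>q n = 0\<close> cancels the infinite value of \<open>inv_powr 1 (T b n)\<close>.\<close>
  define G where "G = (\<lambda>n b. ennreal (q n) * (inv_powr 1 (T b n) * B b))"
  have J: "J < \<infinity>" unfolding J_def by (rule nn_integral_inv_powr_sin_finite) auto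
  have Tm: "(\<lambda>b. T b n) \<in> borel_measurable P" for n
    unfolding T_def P_def
    by (intro borel_measurable_sum borel_measurable_power symbol_component_measurable) auto
  have Bm: "B \<in> borel_measurable P"
    unfolding B_def P_def by measurable
  have Im: "(\<lambda>b. inv_powr 1 (T b n) * B b) \<in> borel_measurable P" for n
    using Bm measurable_compose[OF Tm inv_powr_measurable] by measurable
  have Gm: "G n \<in> borel_measurable P" for n
    unfolding G_def using Im by measurable
  have Sm: "(\<lambda>b. \<integral>\<^sup>+n. G n b \<partial>count_space UNIV) \<in> borel_measurable P"
  proof -
    have "(\<integral>\<^sup>+n. G n b \<partial>count_space UNIV) = (\<Sum>k. G (int_decode k) b)" for b
      by (simp add: nn_integral_bij_count_space[OF bij_int_decode, symmetric] nn_integral_count_space_nat)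
    then show ?thesis using Gm by simp
  qed
  have Gint: "(\<integral>\<^sup>+b. G n b \<partial>P) \<le> ennreal (q n) * (2 * J) ^ (4 * s + 1)" for n
  proof (cases "n = \<alpha> \<or> n = \<beta>")
    case True
    then show ?thesis using 0 by (auto simp: G_def q_def)
  next
    case False
    have "(\<integral>\<^sup>+b. G n b \<partial>P) = ennreal (q n) * (\<integral>\<^sup>+b. inv_powr 1 (T b n) * B b \<partial>P)"
      unfolding G_def by (rule nn_integral_cmult[OF Im])
    also have "\<dots> \<le> ennreal (q n) * (2 * J) ^ (4 * s + 1)"
      unfolding T_def B_def P_def J_def
      using False by (intro mult_left_mono nn_integral_inverse_symbol_sum) simp_all
    finally show ?thesis .
  qed
  have "Infinite_Set_Sum.abs_summable_on q UNIV"
    using fourier_summable[OF f] unfolding q_def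
    by (subst abs_summable_equivalent[symmetric]) (simp add: summable_on_iff_abs_summable_on_real[symmetric])
  then have "(\<integral>\<^sup>+n. ennreal (q n) \<partial>count_space UNIV) < \<infinity>"
    unfolding Infinite_Set_Sum.abs_summable_on_def integrable_iff_bounded by (simp add: q_def)
  then have fin: "(\<integral>\<^sup>+n. ennreal (q n) \<partial>count_space UNIV) * (2 * J) ^ (4 * s + 1) < \<infinity>"
    using J by (simp only: ennreal_mult_less_top power_less_top_ennreal infinity_ennreal_def) simp
  have "(\<integral>\<^sup>+b. (\<integral>\<^sup>+n. G n b \<partial>count_space UNIV) \<partial>P) = (\<integral>\<^sup>+n. (\<integral>\<^sup>+b. G n b \<partial>P) \<partial>count_space UNIV)"
    by (rule nn_integral_count_space_nn_integral) (auto intro: Gm)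
  also have "\<dots> \<le> (\<integral>\<^sup>+n. ennreal (q n) * (2 * J) ^ (4 * s + 1) \<partial>count_space UNIV)"
    by (intro nn_integral_mono Gint)
  also have "\<dots> = (\<integral>\<^sup>+n. ennreal (q n) \<partial>count_space UNIV) * (2 * J) ^ (4 * s + 1)"
    by (rule nn_integral_multc) auto
  finally have "(\<integral>\<^sup>+b. (\<integral>\<^sup>+n. G n b \<partial>count_space UNIV) \<partial>P) \<noteq> \<infinity>"
    using fin by (auto simp: less_top)
  then have "AE b in P. (\<integral>\<^sup>+n. G n b \<partial>count_space UNIV) \<noteq> \<infinity>"
    by (intro nn_integral_noteq_infinite Sm)
  then have "AE b in P. (\<forall>j\<in>{1..4 * s + 1}. b j \<in> {0..2 * pi}) \<longrightarrow> is_diff_sum \<alpha> \<beta> s (4 * s + 1) b f"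
  proof eventually_elim
    case (elim b)
    show ?case
    proof
      assume box: "\<forall>j\<in>{1..4 * s + 1}. b j \<in> {0..2 * pi}"
      then have B: "B b = 1" unfolding B_def by (intro prod.neutral) auto
      have zero: "fourier f n = 0" if "T b n = 0" for n
      proof (rule ccontr)
        assume "fourier f n \<noteq> 0"
        then have "G n b = \<infinity>"
          using that by (simp add: G_def q_def B inv_powr_def ennreal_mult_top)
        moreover have "G n b \<le> (\<integral>\<^sup>+n. G n b \<partial>count_space UNIV)"
          by (rule nn_integral_ge_point) simp
        ultimately show False using elim by (simp add: top_unique)
      qed
      have T0: "T b n \<ge> 0" for n unfolding T_def by (intro sum_nonneg) (simp add: power_mult)
      have le: "ennreal (q n / T b n) \<le> G n b" for n
      proof (cases "T b n = 0")
        case False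
        then have "ennreal (q n / T b n) = ennreal (q n) * ennreal (\<bar>T b n\<bar> powr - 1)"
          using T0[of n] by (subst ennreal_mult[symmetric]) (auto simp: q_def powr_minus field_simps)
        then show ?thesis
          using False by (simp add: G_def B inv_powr_def)
      qed simp
      have "(\<integral>\<^sup>+n. ennreal (q n / T b n) \<partial>count_space UNIV) \<le> (\<integral>\<^sup>+n. G n b \<partial>count_space UNIV)"
        by (intro nn_integral_mono le)
      then have "integrable (count_space UNIV) (\<lambda>n. q n / T b n)"
        using elim T0 by (intro integrableI_nonneg) (auto simp: q_def less_top[symmetric] top_unique)
      then have "Infinite_Set_Sum.abs_summable_on (\<lambda>n. q n / T b n) UNIV"
        by (simp only: Infinite_Set_Sum.abs_summable_on_def)
      then have "(\<lambda>n. norm (q n / T b n)) summable_on UNIV"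
        by (rule abs_summable_equivalent[THEN iffD2])
      then have "(\<lambda>n. q n / T b n) summable_on UNIV"
        by (rule summable_on_iff_abs_summable_on_real[THEN iffD2])
      then show "is_diff_sum \<alpha> \<beta> s (4 * s + 1) b f"
        using zero by (intro is_diff_sum_of_summable f) (auto simp: q_def T_def)
    qed
  qed
  then show ?thesis by (simp only: P_def)
qed

text \<open>The cube has positive measure, so a property that holds almost everywhere on it holds somewhere on it.\<close>

lemma ex_is_diff_sum:
  assumes "f \<in> L2" "fourier f \<alpha> = 0" "fourier f \<beta> = 0"
  shows "\<exists>b. (\<forall>j\<in>{1..4 * s + 1}. b j \<in> {0..2 * pi}) \<and> is_diff_sum \<alpha> \<beta> s (4 * s + 1) b f"
proof (rule ccontr)
  assume no: "\<not> ?thesis"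
  let ?I = "{1..4 * s + 1}"
  let ?P = "Pi\<^sub>M ?I (\<lambda>_. lborel :: real measure)"
  let ?B = "PiE ?I (\<lambda>_. {0..2 * pi})"
  have "AE b in ?P. b \<notin> ?B"
    using AE_is_diff_sum[OF assms, of s]
  proof eventually_elim
    case (elim b)
    then show ?case using no by (auto simp: PiE_iff)
  qed
  moreover have "?B \<in> sets ?P" by (intro sets_PiM_I_finite) auto
  ultimately have "emeasure ?P ?B = 0"
    by (simp add: AE_iff_null_sets[symmetric] null_setsD1)
  moreover have "emeasure ?P ?B = (\<Prod>j\<in>?I. emeasure lborel {0..2 * pi})"
    by (intro lborel_product.emeasure_PiM) auto
  ultimately show False by (simp add: prod_zero_iff)
qed

section \<open>The characterisation\<close>

lemma topspace_L2: "topspace L2_topology = L2"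
proof (rule antisym)
  show "topspace L2_topology \<subseteq> L2"
    using openin_topspace[of L2_topology] unfolding openin_L2_topology by blast
  show "L2 \<subseteq> topspace L2_topology"
    by (rule openin_subset) (auto simp: openin_L2_topology intro: exI[of _ 1])
qed

lemma closedin_fourier_zeros: "closedin L2_topology {f \<in> L2. fourier f \<alpha> = 0 \<and> fourier f \<beta> = 0}"
  unfolding closedin_def topspace_L2 openin_L2_topology
proof (intro conjI ballI)
  fix f assume "f \<in> L2 - {f \<in> L2. fourier f \<alpha> = 0 \<and> fourier f \<beta> = 0}"
  then obtain n where f: "f \<in> L2" "fourier f n \<noteq> 0" and n: "n = \<alpha> \<or> n = \<beta>" by auto
  show "\<exists>e>0. \<forall>g\<in>L2. L2_norm (g - f) < e \<longrightarrow> g \<in> L2 - {f \<in> L2. fourier f \<alpha> = 0 \<and> fourier f \<beta> = 0}"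
  proof (intro exI[of _ "cmod (fourier f n)"] conjI ballI impI)
    fix g assume g: "g \<in> L2" "L2_norm (g - f) < cmod (fourier f n)"
    have "fourier g n \<noteq> 0"
    proof
      assume "fourier g n = 0"
      then have "cmod (fourier (\<lambda>t. g t - f t) n) = cmod (fourier f n)"
        using f g by (simp add: fourier_diff)
      moreover have "cmod (fourier (\<lambda>t. g t - f t) n) \<le> L2_norm (\<lambda>t. g t - f t)"
        by (rule fourier_le_norm[OF L2_diff[OF g(1) f(1)]])
      ultimately show False using g(2) by (simp add: fun_diff_def)
    qed
    then show "g \<in> L2 - {f \<in> L2. fourier f \<alpha> = 0 \<and> fourier f \<beta> = 0}" using g n by auto
  qed (use f in auto)
qed auto

lemma subspace_fourier_zeros: "L2_fun.subspace {f \<in> L2. fourier f \<alpha> = 0 \<and> fourier f \<beta> = 0}"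
  unfolding L2_fun.subspace_def
  by (auto simp: zero_fun_def plus_fun_def L2_zero L2_add L2_cmult fourier_zero fourier_add fourier_cmult)

theorem theorem2p3:
  fixes \<alpha> \<beta> :: int
  shows
    "(\<forall>f\<in>L2.
        ((fourier f \<alpha> = 0 \<and> fourier f \<beta> = 0) \<longleftrightarrow>
           (\<exists>m s b. m \<ge> 1 \<and> s \<ge> 1 \<and> (\<forall>j\<in>{1..m}. b j \<in> {0..2 * pi}) \<and> is_diff_sum \<alpha> \<beta> s m b f)) \<and>
        ((fourier f \<alpha> = 0 \<and> fourier f \<beta> = 0) \<longleftrightarrow>
           (\<exists>s b. s \<ge> 1 \<and> (\<forall>j\<in>{1..4 * s + 1}. b j \<in> {0..2 * pi}) \<and>
              is_diff_sum \<alpha> \<beta> s (4 * s + 1) b f)) \<and>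
        ((fourier f \<alpha> = 0 \<and> fourier f \<beta> = 0) \<longleftrightarrow>
           (\<exists>s\<ge>1. \<exists>g\<in>sobolev (2 * s). AE t in circle. (quad_op \<alpha> \<beta> ^^ s) g t = f t)))
     \<and> (\<forall>f\<in>L2. \<forall>s\<ge>1. fourier f \<alpha> = 0 \<and> fourier f \<beta> = 0 \<longrightarrow>
          (AE b in Pi\<^sub>M {1..4 * s + 1} (\<lambda>_. lborel).
             (\<forall>j\<in>{1..4 * s + 1}. b j \<in> {0..2 * pi}) \<longrightarrow> is_diff_sum \<alpha> \<beta> s (4 * s + 1) b f))
     \<and> (\<forall>s\<ge>1. let S = {f \<in> L2. \<exists>b. (\<forall>j\<in>{1..4 * s + 1}. b j \<in> {0..2 * pi}) \<and>
                            is_diff_sum \<alpha> \<beta> s (4 * s + 1) b f}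
          in L2_fun.subspace S \<and> closedin L2_topology S)"
proof (intro conjI ballI allI impI)
  fix f assume f: "f \<in> L2"
  let ?i = "fourier f \<alpha> = 0 \<and> fourier f \<beta> = 0"
  let ?ii = "\<exists>m s b. m \<ge> 1 \<and> s \<ge> 1 \<and> (\<forall>j\<in>{1..m}. b j \<in> {0..2 * pi}) \<and> is_diff_sum \<alpha> \<beta> s m b f"
  let ?iii = "\<exists>s b. s \<ge> 1 \<and> (\<forall>j\<in>{1..4 * s + 1}. b j \<in> {0..2 * pi}) \<and> is_diff_sum \<alpha> \<beta> s (4 * s + 1) b f"
  let ?iv = "\<exists>s\<ge>1. \<exists>g\<in>sobolev (2 * s). AE t in circle. (quad_op \<alpha> \<beta> ^^ s) g t = f t"
  have i_iii: "?iii" if ?i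
  proof -
    from ex_is_diff_sum[OF f, of \<alpha> \<beta> 1] that obtain b where
      "\<forall>j\<in>{1..4 * 1 + 1}. b j \<in> {0..2 * pi}" "is_diff_sum \<alpha> \<beta> 1 (4 * 1 + 1) b f" by blast
    then show ?thesis by (intro exI[of _ "1::nat"] exI[of _ b]) auto
  qed
  have iii_ii: "?ii" if ?iii
  proof -
    from that obtain s b where "s \<ge> 1" "\<forall>j\<in>{1..4 * s + 1}. b j \<in> {0..2 * pi}"
      "is_diff_sum \<alpha> \<beta> s (4 * s + 1) b f" by blast
    then show ?thesis by (intro exI[of _ "4 * s + 1"] exI[of _ s] exI[of _ b]) auto
  qed
  have ii_i: "?i" if ?ii
    using that fourier_eq_0_of_is_diff_sum[OF f] by blast
  show "?i \<longleftrightarrow> ?ii" using i_iii iii_ii ii_i by blast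
  show "?i \<longleftrightarrow> ?iii" using i_iii iii_ii ii_i by blast
  show "?i \<longleftrightarrow> ?iv"
  proof
    assume ?i
    then obtain g where "g \<in> sobolev 2" "AE t in circle. quad_op \<alpha> \<beta> g t = f t"
      using ex_quad_op_eq[OF f] by blast
    then show ?iv by (intro exI[of _ 1]) auto
  next
    assume ?iv
    then obtain s g where s: "s \<ge> 1" and g: "g \<in> sobolev (0 + 2 * s)"
      and ae: "AE t in circle. (quad_op \<alpha> \<beta> ^^ s) g t = f t" by auto
    have "fourier f n = (- of_int ((n - \<alpha>) * (n - \<beta>))) ^ s * fourier g n" for n
      using fourier_cong_AE[OF L2_measurable[OF sobolev_L2[OF quad_op_power_sobolev(1)[OF g]]]
          L2_measurable[OF f] ae, of n]
      by (simp only: quad_op_power_sobolev(2)[OF g])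
    then show ?i using s by (simp add: power_0_left)
  qed
next
  fix f and s :: nat assume "f \<in> L2" "fourier f \<alpha> = 0 \<and> fourier f \<beta> = 0"
  then show "AE b in Pi\<^sub>M {1..4 * s + 1} (\<lambda>_. lborel).
      (\<forall>j\<in>{1..4 * s + 1}. b j \<in> {0..2 * pi}) \<longrightarrow> is_diff_sum \<alpha> \<beta> s (4 * s + 1) b f"
    by (intro AE_is_diff_sum) auto
next
  fix s :: nat assume s: "s \<ge> 1"
  have eq: "{f \<in> L2. \<exists>b. (\<forall>j\<in>{1..4 * s + 1}. b j \<in> {0..2 * pi}) \<and> is_diff_sum \<alpha> \<beta> s (4 * s + 1) b f}
      = {f \<in> L2. fourier f \<alpha> = 0 \<and> fourier f \<beta> = 0}"
    using ex_is_diff_sum fourier_eq_0_of_is_diff_sum[OF _ s] by blast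
  show "let S = {f \<in> L2. \<exists>b. (\<forall>j\<in>{1..4 * s + 1}. b j \<in> {0..2 * pi}) \<and>
                            is_diff_sum \<alpha> \<beta> s (4 * s + 1) b f}
          in L2_fun.subspace S \<and> closedin L2_topology S"
    unfolding Let_def eq by (intro conjI subspace_fourier_zeros closedin_fourier_zeros)
qed

end
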